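(* Let $A=\{0,1\}$. There are exactly 13 distinct relationally defined permutation clones on $A$.
   Context: Let $A$ be a finite set. For $n\in\mathbb{N}$ let $B_n(A)=\mathrm{Sym}(A^n)$ and $B(A)=\bigcup_{n\in\mathbb{N}}B_n(A)$. For $\alpha\in S_n$ the wire permutation $\pi_\alpha\in B_n(A)$ is $(x_1,\dots,x_n)\mapsto(x_{\alpha^{-1}(1)},\dots,x_{\alpha^{-1}(n)})$; $i_n$ denotes the identity of $A^n$. For $f\in B_n(A)$, $g\in B_m(A)$, the parallel composition $f\oplus g\in B_{n+m}(A)$ applies $f$ to the first $n$ coordinates and $g$ to the last $m$ coordinates. Serial composition $f\bullet g$ is composition in $\mathrm{Sym}(A^n)$ when both have arity $n$; if the arities differ, the one of smaller arity $r$ is first replaced by its parallel composition with $i_{s-r}$, $s$ the larger arity. A permutation clone is a subset of $B(A)$ containing all wire permutations and closed under $\oplus$ and $\bullet$. For a relation $R\subseteq A^k$ and $f\in B_n(A)$, say $f$ respects $R$ if for every $k\times n$ array over $A$ whose columns all lie in $R$, the array obtained by applying $f$ to each row also has all columns in $R$. $\mathrm{PPol}(R)$ is the set of all $f\in B(A)$ respecting $R$ (equivalently, the polymorphisms of the weight $w_R:A^k\to(\{0,1\},\wedge)$, the characteristic function of $R$). A relationally defined permutation clone is a permutation clone of the form $\mathrm{PPol}(R)$ for some relation $R\subseteq A^k$, $k\ge 1$. *)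

theory Defs
  imports "HOL-Combinatorics.Permutations" "HOL-Library.NList"
begin

text \<open>The power \<open>A\<^sup>n\<close> is \<^term>\<open>nlists n A\<close>, the set of lists of length \<open>n\<close> over \<open>A\<close>, with
  coordinates numbered from \<open>0\<close>. An element of \<open>B(A)\<close> is a pair of its arity \<open>n\<close> and a function
  permuting \<open>A\<^sup>n\<close>. The arity has to be stored because \<open>permutes\<close> extends a function by the
  identity outside \<open>A\<^sup>n\<close>, so that for example the identities of different arities would otherwise
  coincide; with it, the representation is unique.\<close>

type_synonym 'a pmap = "nat \<times> ('a list \<Rightarrow> 'a list)"

definition Bn :: "'a set \<Rightarrow> nat \<Rightarrow> 'a pmap set" where
  "Bn A n = {(n, f) | f. f permutes nlists n A}"

definition BA :: "'a set \<Rightarrow> 'a pmap set" where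
  "BA A = (\<Union>n. Bn A n)"

definition ident :: "nat \<Rightarrow> 'a pmap" where
  "ident n = (n, id)"

definition wire_perm :: "'a set \<Rightarrow> nat \<Rightarrow> (nat \<Rightarrow> nat) \<Rightarrow> 'a pmap" where
  "wire_perm A n \<alpha> =
     (n, \<lambda>xs. if xs \<in> nlists n A then map (\<lambda>i. xs ! inv \<alpha> i) [0..<n] else xs)"

definition parallel :: "'a set \<Rightarrow> 'a pmap \<Rightarrow> 'a pmap \<Rightarrow> 'a pmap" where
  "parallel A F G = (case (F, G) of ((n, f), (m, g)) \<Rightarrow>
     (n + m, \<lambda>xs. if xs \<in> nlists (n + m) A then f (take n xs) @ g (drop n xs) else xs))"

definition pad :: "'a set \<Rightarrow> nat \<Rightarrow> 'a pmap \<Rightarrow> 'a pmap" where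
  "pad A s F = (if fst F < s then parallel A F (ident (s - fst F)) else F)"

definition serial :: "'a set \<Rightarrow> 'a pmap \<Rightarrow> 'a pmap \<Rightarrow> 'a pmap" where
  "serial A F G = (let s = max (fst F) (fst G) in (s, snd (pad A s F) \<circ> snd (pad A s G)))"

definition permutation_clone :: "'a set \<Rightarrow> 'a pmap set \<Rightarrow> bool" where
  "permutation_clone A C \<longleftrightarrow>
     C \<subseteq> BA A \<and>
     (\<forall>n \<alpha>. \<alpha> permutes {..<n} \<longrightarrow> wire_perm A n \<alpha> \<in> C) \<and>
     (\<forall>F\<in>C. \<forall>G\<in>C. parallel A F G \<in> C) \<and>
     (\<forall>F\<in>C. \<forall>G\<in>C. serial A F G \<in> C)"

text \<open>A \<open>k \<times> n\<close> array over \<open>A\<close> is the list of its \<open>k\<close> rows, each in \<open>A\<^sup>n\<close>.\<close>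

definition column :: "'a list list \<Rightarrow> nat \<Rightarrow> 'a list" where
  "column M j = map (\<lambda>row. row ! j) M"

definition respects_rel :: "'a set \<Rightarrow> nat \<Rightarrow> 'a list set \<Rightarrow> 'a pmap \<Rightarrow> bool" where
  "respects_rel A k R F = (case F of (n, f) \<Rightarrow>
     \<forall>M \<in> nlists k (nlists n A).
       (\<forall>j<n. column M j \<in> R) \<longrightarrow> (\<forall>j<n. column (map f M) j \<in> R))"

definition PPol :: "'a set \<Rightarrow> nat \<Rightarrow> 'a list set \<Rightarrow> 'a pmap set" where
  "PPol A k R = {F \<in> BA A. respects_rel A k R F}"

definition relationally_defined_clone :: "'a set \<Rightarrow> 'a pmap set \<Rightarrow> bool" where
  "relationally_defined_clone A C \<longleftrightarrow>
     permutation_clone A C \<and> (\<exists>k\<ge>1. \<exists>R \<subseteq> nlists k A. C = PPol A k R)"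

end

theory Submission
  imports Defs
begin

text \<open>
  A permutation of \<open>{0,1}\<^sup>n\<close> respects \<open>R\<close> iff each of its \<open>n\<close> coordinate functions lies in the Boolean
  clone of polymorphisms of \<open>R\<close>. What matters are thus the sets of permutations with all coordinates
  in a given Boolean clone \<open>C\<close>, and most of Post's lattice collapses, for two reasons. A coordinate of
  a permutation is balanced, hence if it is not self-dual it takes both the value \<open>1\<close> and the value \<open>0\<close>
  on some pair of antipodal points. A monotone permutation is an automorphism of the order, hence
  permutes the coordinates. What survives are the intersections of the clones preserving \<open>0\<close>,
  preserving \<open>1\<close>, self-dual and affine (eleven classes), the literals, and the projections: for each
  of them, coordinates of permutations witnessing that no smaller class suffices generate all of it.

  Generation of a clone without constants is reduced to Shannon expansion by working only up to
  agreement on a set \<open>X\<close> of assignments on which suitable members of \<open>C\<close> are constant.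
\<close>

section \<open>Boolean clones\<close>

text \<open>A Boolean clone is not determined by its permutations: it may contain constants,
  conjunctions or majorities that none of its permutations has as a coordinate. So the coordinates
  that do occur decide everything, and the target is the smallest listed class containing them. What
  a coordinate offers beyond mere membership is its balance: two antipodal points with a common
  value, after the variables are identified in two blocks, give a binary operation with a known
  truth table, namely XOR, equivalence, AND or OR.

  Agreement on \<open>X\<close> alone loses nothing, because \<open>X\<close> is chosen so that the
  class itself fixes the remaining values. The assignments left out are the constant ones, where
  \<open>T0\<close> or \<open>T1\<close> prescribes the value, or complements of assignments that
  are kept, where self-duality does. On \<open>X\<close> a variable or a disjunction of variables
  then serves as the missing constant.\<close>

type_synonym bfun = "(nat \<Rightarrow> bool) \<Rightarrow> bool"

text \<open>Assignments are total functions on \<^typ>\<open>nat\<close>, so that arities never appear in compositions; the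
  arity is recovered by \<open>fin\<close>. A clone acts on itself, and on its functions up to agreement on a set.\<close>

definition acts :: "bfun set \<Rightarrow> bfun set \<Rightarrow> bool" where
  "acts C S \<longleftrightarrow> (\<forall>i. (\<lambda>x. x i) \<in> S) \<and>
     (\<forall>H\<in>C. \<forall>G. (\<forall>i. G i \<in> S) \<longrightarrow> (\<lambda>x. H (\<lambda>i. G i x)) \<in> S)"

abbreviation clone :: "bfun set \<Rightarrow> bool" where
  "clone C \<equiv> acts C C"

definition restr :: "bfun set \<Rightarrow> (nat \<Rightarrow> bool) set \<Rightarrow> bfun set" where
  "restr C X = {F. \<exists>G\<in>C. \<forall>x\<in>X. F x = G x}"

definition fin :: "nat \<Rightarrow> bfun \<Rightarrow> bool" where
  "fin n F \<longleftrightarrow> (\<forall>x y. (\<forall>i<n. x i = y i) \<longrightarrow> F x = F y)"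

definition closed2 :: "(bool \<Rightarrow> bool \<Rightarrow> bool) \<Rightarrow> bfun set \<Rightarrow> bool" where
  "closed2 op S \<longleftrightarrow> (\<forall>F\<in>S. \<forall>G\<in>S. (\<lambda>x. op (F x) (G x)) \<in> S)"

definition closed_neg :: "bfun set \<Rightarrow> bool" where
  "closed_neg S \<longleftrightarrow> (\<forall>F\<in>S. (\<lambda>x. \<not> F x) \<in> S)"

definition T0 :: "bfun set" where "T0 = {F. \<not> F (\<lambda>_. False)}"
definition T1 :: "bfun set" where "T1 = {F. F (\<lambda>_. True)}"
definition SD :: "bfun set" where "SD = {F. \<forall>x. F (\<lambda>i. \<not> x i) = (\<not> F x)}"
text \<open>On \<open>bool\<close>, \<open>\<noteq>\<close> is addition modulo 2, so this is
  preservation of x + y + z: affinity stated without coefficients.\<close>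

definition Aff :: "bfun set" where
  "Aff = {F. \<forall>x y z. F (\<lambda>i. x i \<noteq> (y i \<noteq> z i)) = (F x \<noteq> (F y \<noteq> F z))}"
definition Mono :: "bfun set" where
  "Mono = {F. \<forall>x y. (\<forall>i. x i \<longrightarrow> y i) \<longrightarrow> F x \<longrightarrow> F y}"
definition Proj :: "bfun set" where "Proj = range (\<lambda>i x. x i)"
definition Lit :: "bfun set" where "Lit = Proj \<union> range (\<lambda>i x. \<not> x i)"

section \<open>Clones, finitary functions and Shannon expansion\<close>

lemma acts_proj: "acts C S \<Longrightarrow> (\<lambda>x. x i) \<in> S"
  by (simp add: acts_def)

lemma acts_comp: "acts C S \<Longrightarrow> H \<in> C \<Longrightarrow> (\<And>i. G i \<in> S) \<Longrightarrow> (\<lambda>x. H (\<lambda>i. G i x)) \<in> S"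
  by (simp add: acts_def)

lemma closed2D: "closed2 op S \<Longrightarrow> F \<in> S \<Longrightarrow> G \<in> S \<Longrightarrow> (\<lambda>x. op (F x) (G x)) \<in> S"
  by (simp add: closed2_def)

lemma closed_negD: "closed_neg S \<Longrightarrow> F \<in> S \<Longrightarrow> (\<lambda>x. \<not> F x) \<in> S"
  by (simp add: closed_neg_def)

lemma restrI: "G \<in> C \<Longrightarrow> (\<And>x. x \<in> X \<Longrightarrow> F x = G x) \<Longrightarrow> F \<in> restr C X"
  by (auto simp: restr_def)

lemma mem_ext: "G \<in> S \<Longrightarrow> (\<And>x. F x = G x) \<Longrightarrow> F \<in> S"
  by (subgoal_tac "F = G") auto

text \<open>\<open>restr C X\<close> need not be closed under composition, since the inner functions
  may lead out of \<open>X\<close>. Outer functions taken from \<open>C\<close> itself do no harm,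
  which is why \<open>acts\<close> has two arguments.\<close>

lemma acts_restr:
  assumes "clone C"
  shows "acts C (restr C X)"
  unfolding acts_def
proof (intro conjI allI ballI impI)
  fix i show "(\<lambda>x. x i) \<in> restr C X"
    using acts_proj[OF assms] by (auto simp: restr_def)
next
  fix H and G :: "nat \<Rightarrow> bfun"
  assume H: "H \<in> C" and "\<forall>i. G i \<in> restr C X"
  then have "\<forall>i. \<exists>G'. G' \<in> C \<and> (\<forall>x\<in>X. G i x = G' x)"
    by (auto simp: restr_def)
  then obtain G' where G': "\<And>i. G' i \<in> C" "\<And>i x. x \<in> X \<Longrightarrow> G i x = G' i x"
    by metis
  have "(\<lambda>x. H (\<lambda>i. G' i x)) \<in> C"
    by (rule acts_comp[OF assms H G'(1)])
  then show "(\<lambda>x. H (\<lambda>i. G i x)) \<in> restr C X"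
    by (rule restrI) (simp add: G'(2))
qed

lemma restr_cong: "G \<in> restr C X \<Longrightarrow> (\<And>x. x \<in> X \<Longrightarrow> F x = G x) \<Longrightarrow> F \<in> restr C X"
  by (auto simp: restr_def)

lemma clone_Int: "clone C \<Longrightarrow> clone D \<Longrightarrow> clone (C \<inter> D)"
  by (simp add: acts_def)

lemma clone_T0: "clone T0" by (simp add: acts_def T0_def)
lemma clone_T1: "clone T1" by (simp add: acts_def T1_def)
lemma clone_SD: "clone SD" by (simp add: acts_def SD_def)
lemma clone_Aff: "clone Aff" by (simp add: acts_def Aff_def)

lemma finI: "(\<And>x y. (\<And>i. i < n \<Longrightarrow> x i = y i) \<Longrightarrow> F x = F y) \<Longrightarrow> fin n F"
  unfolding fin_def by (intro allI impI) (drule meta_spec, drule meta_spec, erule meta_mp, blast)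

lemma finD: "fin n F \<Longrightarrow> (\<And>i. i < n \<Longrightarrow> x i = y i) \<Longrightarrow> F x = F y"
  unfolding fin_def by blast

lemma fin_mono: "fin n F \<Longrightarrow> n \<le> m \<Longrightarrow> fin m F"
  by (rule finI, rule finD[of n]) auto

lemma fin_neg: "fin n F \<Longrightarrow> fin n (\<lambda>x. \<not> F x)"
  by (simp add: fin_def)

lemma fin_upd: "fin (Suc n) F \<Longrightarrow> fin n (\<lambda>x. F (x(n := c)))"
  by (rule finI, erule finD) (auto simp: less_Suc_eq)

lemma fin_0: "fin 0 F \<Longrightarrow> F = (\<lambda>_. True) \<or> F = (\<lambda>_. False)"
proof -
  assume "fin 0 F"
  then have "F x = F (\<lambda>_. False)" for x by (rule finD) simp
  then show ?thesis by (cases "F (\<lambda>_. False)") auto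
qed

lemma fin_in_closed:
  assumes proj: "\<And>i. (\<lambda>x. x i) \<in> S" and tt: "(\<lambda>_. True) \<in> S" and ff: "(\<lambda>_. False) \<in> S"
    and conj: "closed2 (\<and>) S" and neg: "closed_neg S"
  shows "fin n F \<Longrightarrow> F \<in> S"
proof (induction n arbitrary: F)
  case 0
  then show ?case using fin_0[OF 0] tt ff by auto
next
  case (Suc n)
  have 0: "(\<lambda>x. F (x(n := False))) \<in> S" and 1: "(\<lambda>x. F (x(n := True))) \<in> S"
    by (rule Suc.IH[OF fin_upd[OF Suc.prems]])+
  \<comment> \<open>Shannon expansion at variable \<open>n\<close>, with the disjunction written
    through negation and conjunction.\<close>
  have "(\<lambda>x. \<not> (\<not> (x n \<and> F (x(n := True))) \<and> \<not> (\<not> x n \<and> F (x(n := False))))) \<in> S"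
    by (intro closed_negD[OF neg] closed2D[OF conj] proj 0 1)
  moreover have "(\<lambda>x. \<not> (\<not> (x n \<and> F (x(n := True))) \<and> \<not> (\<not> x n \<and> F (x(n := False))))) = F"
  proof
    fix x :: "nat \<Rightarrow> bool"
    have "x(n := x n) = x" by simp
    then show "(\<not> (\<not> (x n \<and> F (x(n := True))) \<and> \<not> (\<not> x n \<and> F (x(n := False))))) = F x"
      by (cases "x n") simp_all
  qed
  ultimately show ?case by simp
qed

section \<open>Affine functions as sums of variables\<close>

lemma AffD: "F \<in> Aff \<Longrightarrow> F (\<lambda>i. x i \<noteq> (y i \<noteq> z i)) = (F x \<noteq> (F y \<noteq> F z))"
  unfolding Aff_def mem_Collect_eq by (erule allE, erule allE, erule allE, assumption)

lemma SDD: "F \<in> SD \<Longrightarrow> F (\<lambda>i. \<not> x i) = (\<not> F x)"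
  unfolding SD_def mem_Collect_eq by (erule allE, assumption)

lemma Aff_T0_add:
  assumes "F \<in> Aff" "F \<in> T0"
  shows "F (\<lambda>i. x i \<noteq> y i) = (F x \<noteq> F y)"
proof -
  show ?thesis using AffD[OF assms(1), of x y "\<lambda>_. False"] assms(2) by (simp add: T0_def)
qed

lemma Aff_T0I:
  assumes "\<And>x y. F (\<lambda>i. x i \<noteq> y i) = (F x \<noteq> F y)"
  shows "F \<in> Aff \<inter> T0"
proof -
  have "F (\<lambda>i. x i \<noteq> (y i \<noteq> z i)) = (F x \<noteq> (F y \<noteq> F z))" for x y z
    using assms[of x "\<lambda>i. y i \<noteq> z i"] assms[of y z] by simp
  moreover have "\<not> F (\<lambda>_. False)"
    using assms[of "\<lambda>_. False" "\<lambda>_. False"] by simp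
  ultimately show ?thesis by (simp add: Aff_def T0_def)
qed

lemma Aff_neg: "F \<in> Aff \<Longrightarrow> (\<lambda>x. \<not> F x) \<in> Aff"
  by (auto simp: Aff_def)

lemma SD_neg: "F \<in> SD \<Longrightarrow> (\<lambda>x. \<not> F x) \<in> SD"
  by (auto simp: SD_def)

text \<open>The additive counterpart of Shannon expansion: an assignment is itself with place
  \<open>n\<close> cleared, plus the unit vector at \<open>n\<close> if that place was True.\<close>

lemma Aff_T0_split:
  assumes "F \<in> Aff" "F \<in> T0"
  shows "F x = (F (x(n := False)) \<noteq> (x n \<and> F (\<lambda>i. i = n)))"
proof (cases "x n")
  case True
  have "F x = F (\<lambda>i. (x(n := False)) i \<noteq> (i = n))"
    by (rule arg_cong[of _ _ F]) (auto simp: True)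
  also have "\<dots> = (F (x(n := False)) \<noteq> F (\<lambda>i. i = n))"
    by (rule Aff_T0_add[OF assms])
  finally show ?thesis using True by simp
next
  case False
  then have "x(n := False) = x" by (intro ext) simp
  then show ?thesis using False by simp
qed

lemma Aff_T0_upd:
  assumes "F \<in> Aff" "F \<in> T0"
  shows "(\<lambda>x. F (x(n := False))) \<in> Aff \<inter> T0"
proof (rule Aff_T0I)
  fix x y
  have "(\<lambda>i. x i \<noteq> y i)(n := False) = (\<lambda>i. (x(n := False)) i \<noteq> (y(n := False)) i)"
    by (intro ext) simp
  then have "F ((\<lambda>i. x i \<noteq> y i)(n := False)) = F (\<lambda>i. (x(n := False)) i \<noteq> (y(n := False)) i)"
    by (rule arg_cong)
  then show "F ((\<lambda>i. x i \<noteq> y i)(n := False)) = (F (x(n := False)) \<noteq> F (y(n := False)))"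
    by (rule trans[OF _ Aff_T0_add[OF assms]])
qed

lemma fin_Aff_in_closed:
  assumes proj: "\<And>i. (\<lambda>x. x i) \<in> S" and ff: "(\<lambda>_. False) \<in> S" and xor: "closed2 (\<noteq>) S"
  shows "fin n F \<Longrightarrow> F \<in> Aff \<Longrightarrow> F \<in> T0 \<Longrightarrow> F \<in> S"
proof (induction n arbitrary: F)
  case 0
  then show ?case using fin_0[of F] ff by (auto simp: T0_def)
next
  case (Suc n)
  have 0: "(\<lambda>x. F (x(n := False))) \<in> S"
    using Suc.IH[OF fin_upd[OF Suc.prems(1)]] Aff_T0_upd[OF Suc.prems(2,3)] by blast
  have eq: "F x = (F (x(n := False)) \<noteq> (x n \<and> F (\<lambda>i. i = n)))" for x
    by (rule Aff_T0_split[OF Suc.prems(2,3)])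
  show ?case
  proof (cases "F (\<lambda>i. i = n)")
    case True
    have "F x = (F (x(n := False)) \<noteq> x n)" for x using eq[of x] True by simp
    then show ?thesis by (rule mem_ext[OF closed2D[OF xor 0 proj[of n]]])
  next
    case False
    have "F x = F (x(n := False))" for x using eq[of x] False by simp
    then show ?thesis by (rule mem_ext[OF 0])
  qed
qed

section \<open>Operations obtained by identifying variables\<close>

lemma acts_binop:
  assumes "acts C S" "H \<in> C"
  shows "closed2 (\<lambda>p q. H (\<lambda>i. if a i then p else q)) S"
  unfolding closed2_def
proof (intro ballI)
  fix F G assume FG: "F \<in> S" "G \<in> S"
  have "(\<lambda>x. H (\<lambda>i. (if a i then F else G) x)) \<in> S"
    by (rule acts_comp[OF assms]) (use FG in simp)
  moreover have "(\<lambda>x. H (\<lambda>i. (if a i then F else G) x)) = (\<lambda>x. H (\<lambda>i. if a i then F x else G x))"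
    by (simp only: if_distribR)
  ultimately show "(\<lambda>x. H (\<lambda>i. if a i then F x else G x)) \<in> S" by simp
qed

text \<open>Feeding \<open>p\<close> to the block \<open>a\<close> and \<open>q\<close> to the rest
  leaves a binary operation whose four table entries are the values of \<open>H\<close> at the two
  constants, at \<open>a\<close> and at the complement of \<open>a\<close>. This is where antipodal
  points enter.\<close>

lemma acts_binop_eq:
  assumes "acts C S" "H \<in> C"
    and "H (\<lambda>_. False) = op False False" "H (\<lambda>_. True) = op True True"
    and "H a = op True False" "H (\<lambda>i. \<not> a i) = op False True"
  shows "closed2 op S"
proof -
  have "(\<lambda>p q. H (\<lambda>i. if a i then p else q)) = op"
  proof (intro ext)
    fix p q show "H (\<lambda>i. if a i then p else q) = op p q"
      using assms(3-6) by (cases p; cases q) simp_all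
  qed
  then show ?thesis using acts_binop[OF assms(1,2), of a] by simp
qed

lemma acts_ternary:
  assumes "acts C S" "H \<in> C" "F \<in> S" "G \<in> S" "K \<in> S"
  shows "(\<lambda>v. H (\<lambda>i. if x i then F v else if y i then G v else K v)) \<in> S"
proof -
  have "(\<lambda>v. H (\<lambda>i. (if x i then F else if y i then G else K) v)) \<in> S"
    by (rule acts_comp[OF assms(1,2)]) (use assms in simp)
  moreover have "(\<lambda>v. H (\<lambda>i. (if x i then F else if y i then G else K) v))
      = (\<lambda>v. H (\<lambda>i. if x i then F v else if y i then G v else K v))"
    by (simp only: if_distribR)
  ultimately show ?thesis by simp
qed

text \<open>An odd sum of values means that the polynomial of \<open>op\<close> contains the product
  pq; such an operation is AND up to negating inputs and output.\<close>

lemma closed2_and_of_odd: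
  assumes op: "closed2 op S" and neg: "closed_neg S"
    and odd: "op False False \<noteq> (op True False \<noteq> (op False True \<noteq> op True True))"
  shows "closed2 (\<and>) S"
proof -
  have "\<exists>a b c. \<forall>p q. (p \<and> q) = (op (p \<noteq> a) (q \<noteq> b) \<noteq> c)"
  proof -
    \<comment> \<open>If \<open>op\<close> is pq + bp + aq plus a constant, it equals (p + a)(q + b)
      plus a constant. Thus \<open>a\<close> and \<open>b\<close> are the linear coefficients, read
      off as differences at \<open>True\<close>, and \<open>c\<close> is fitted at p = q =
      1.\<close>
    define a where "a = (op True True = op True False)"
    define b where "b = (op True True = op False True)"
    define c where "c = (\<not> op (True \<noteq> a) (True \<noteq> b))"
    have "(p \<and> q) = (op (p \<noteq> a) (q \<noteq> b) \<noteq> c)" for p q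
      using odd unfolding c_def a_def b_def
      by (cases p; cases q; cases "op True True"; cases "op True False"; cases "op False True"; cases "op False False") simp_all
    then show ?thesis by blast
  qed
  then obtain a b c where e: "\<And>p q. (p \<and> q) = (op (p \<noteq> a) (q \<noteq> b) \<noteq> c)" by blast
  have sh: "(\<lambda>x. F x \<noteq> d) \<in> S" if "F \<in> S" for F d
    using that closed_negD[OF neg that] by (cases d) simp_all
  show ?thesis
    unfolding closed2_def e
    by (intro ballI sh closed2D[OF op])
qed

lemma nonaffine_and:
  assumes act: "acts C S" and H: "H \<in> C" "H \<notin> Aff"
    and tt: "(\<lambda>_. True) \<in> S" and ff: "(\<lambda>_. False) \<in> S" and neg: "closed_neg S"
  shows "closed2 (\<and>) S"
proof -
  obtain x y z where viol: "H (\<lambda>i. x i \<noteq> (y i \<noteq> z i)) \<noteq> (H x \<noteq> (H y \<noteq> H z))"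
    using H(2) by (auto simp: Aff_def)
  \<comment> \<open>A cube through \<open>z\<close>: \<open>p\<close> flips the places where only
    \<open>x\<close> differs from \<open>z\<close>, \<open>q\<close> those where only
    \<open>y\<close> does, \<open>r\<close> those where both do. It contains all four points of the
    violated identity.\<close>
  define s where "s p q r i = (z i \<noteq> (if x i \<noteq> z i then (if y i \<noteq> z i then r else p)
       else (if y i \<noteq> z i then q else False)))" for p q r i
  define h where "h p q r = H (s p q r)" for p q r
  have sS: "(\<lambda>v. s (P v) (Q v) (R v) i) \<in> S" if "P \<in> S" "Q \<in> S" "R \<in> S" for P Q R i
    using that closed_negD[OF neg] tt ff unfolding s_def
    by (cases "x i"; cases "y i"; cases "z i") simp_all
  have hS: "(\<lambda>v. h (P v) (Q v) (R v)) \<in> S" if "P \<in> S" "Q \<in> S" "R \<in> S" for P Q R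
    unfolding h_def using acts_comp[OF act H(1) sS[OF that]] by simp
  have c: "(\<lambda>_. b) \<in> S" for b using tt ff by (cases b) auto
  have faces: "closed2 (\<lambda>p q. h b p q) S" "closed2 (\<lambda>p q. h p b q) S" "closed2 (\<lambda>p q. h p q b) S" for b
    unfolding closed2_def by (intro ballI hS c; assumption)+
  have e1: "s False False False = z" by (intro ext) (auto simp: s_def)
  have e2: "s True False True = x" by (intro ext) (auto simp: s_def)
  have e3: "s False True True = y" by (intro ext) (auto simp: s_def)
  have e4: "s True True False = (\<lambda>i. x i \<noteq> (y i \<noteq> z i))" by (intro ext) (auto simp: s_def)
  have "h True True False \<noteq> (h True False True \<noteq> (h False True True \<noteq> h False False False))"
    using viol unfolding h_def e1 e2 e3 e4 .
  note odd = this
  \<comment> \<open>The vertices 110, 101, 011 and 000 add up to zero. If every face of the cube had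
    an even sum, \<open>h\<close> would be affine and its values at these vertices would add up to
    zero as well; hence some face is odd.\<close>
  note and_of = closed2_and_of_odd[OF faces(1) neg] closed2_and_of_odd[OF faces(2) neg]
    closed2_and_of_odd[OF faces(3) neg]
  show ?thesis
    using odd and_of(1)[of False] and_of(1)[of True] and_of(2)[of False] and_of(2)[of True]
      and_of(3)[of False] and_of(3)[of True] by blast
qed

text \<open>Here XOR replaces negation. The additivity defect of \<open>H\<close> on the multiples p
  x and q y vanishes as soon as p or q is 0, because \<open>H\<close> fixes 0, and it is 1 at p = q
  = 1 by the choice of \<open>x\<close> and \<open>y\<close>; so the defect is the conjunction
  itself.\<close>

lemma nonadditive_and:
  assumes act: "acts C S" and H: "H \<in> C" "H \<in> T0" "H \<notin> Aff"
    and ff: "(\<lambda>_. False) \<in> S" and xor: "closed2 (\<noteq>) S"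
  shows "closed2 (\<and>) S"
proof -
  obtain x y where viol: "H (\<lambda>i. x i \<noteq> y i) \<noteq> (H x \<noteq> H y)"
    using Aff_T0I[of H] H(3) by blast
  have c: "(\<lambda>v. b \<and> P v) \<in> S" if "P \<in> S" for b P
    using ff that by (cases b) auto
  have eq: "(p \<and> q) = (H (\<lambda>i. (x i \<and> p) \<noteq> (y i \<and> q)) \<noteq> ((H x \<and> p) \<noteq> (H y \<and> q)))" for p q
    using viol H(2) by (cases p; cases q) (auto simp: T0_def)
  have "(\<lambda>v. H (\<lambda>i. (x i \<and> P v) \<noteq> (y i \<and> Q v)) \<noteq> ((H x \<and> P v) \<noteq> (H y \<and> Q v))) \<in> S"
    if "P \<in> S" "Q \<in> S" for P Q
    by (intro closed2D[OF xor] c that acts_comp[OF act H(1)])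
  then have "(\<lambda>v. P v \<and> Q v) \<in> S" if "P \<in> S" "Q \<in> S" for P Q
    by (rule mem_ext) (rule that | rule eq)+
  then show ?thesis by (simp add: closed2_def)
qed

lemma or_of_xor_and:
  assumes "closed2 (\<noteq>) S" "closed2 (\<and>) S"
  shows "closed2 (\<or>) S"
proof -
  have "(\<lambda>x. F x \<noteq> (G x \<noteq> (F x \<and> G x))) \<in> S" if "F \<in> S" "G \<in> S" for F G
    by (intro closed2D[OF assms(1)] closed2D[OF assms(2)] that)
  moreover have "(\<lambda>x. F x \<noteq> (G x \<noteq> (F x \<and> G x))) = (\<lambda>x. F x \<or> G x)" for F G :: bfun by (intro ext) auto
  ultimately show ?thesis by (simp add: closed2_def)
qed

text \<open>The substitute for the constant True on assignments that are True somewhere up to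
  \<open>n\<close>. The bound is \<open>i \<le> n\<close> so that the disjunction is never
  empty.\<close>

lemma closed_big_or:
  assumes "\<And>i. (\<lambda>x. x i) \<in> S" "closed2 (\<or>) S"
  shows "(\<lambda>x. \<exists>i\<le>n. x i) \<in> S"
proof (induction n)
  case 0 then show ?case using assms(1)[of 0] by simp
next
  case (Suc n)
  have "(\<lambda>x. (\<exists>i\<le>n. x i) \<or> x (Suc n)) \<in> S" by (rule closed2D[OF assms(2) Suc assms(1)])
  then show ?case by (simp add: le_Suc_eq ex_disj_distrib conj_disj_distribR)
qed

lemma closed_big_and:
  assumes "\<And>i. (\<lambda>x. x i) \<in> S" "closed2 (\<and>) S"
  shows "(\<lambda>x. \<forall>i\<le>n. x i) \<in> S"
proof (induction n)
  case 0 then show ?case using assms(1)[of 0] by simp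
next
  case (Suc n)
  have "(\<lambda>x. (\<forall>i\<le>n. x i) \<and> x (Suc n)) \<in> S" by (rule closed2D[OF assms(2) Suc assms(1)])
  moreover have "(\<lambda>x. (\<forall>i\<le>n. x i) \<and> x (Suc n)) = (\<lambda>x. \<forall>i\<le>Suc n. x i)"
    by (auto simp: le_Suc_eq)
  ultimately show ?case by simp
qed

lemma closed_neg_of_xor:
  assumes "closed2 (\<noteq>) S" "(\<lambda>_. True) \<in> S"
  shows "closed_neg S"
  unfolding closed_neg_def using closed2D[OF assms(1) _ assms(2)] by simp

lemma MonoD: "F \<in> Mono \<Longrightarrow> (\<And>i. x i \<Longrightarrow> y i) \<Longrightarrow> F x \<Longrightarrow> F y"
  unfolding Mono_def by blast

lemma not_MonoE:
  assumes "m \<notin> Mono"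
  obtains x y where "\<And>i. x i \<Longrightarrow> y i" "m x" "\<not> m y"
  using assms by (auto simp: Mono_def)

text \<open>Constants are plugged in where \<open>x\<close> and \<open>y\<close> agree, and
  \<open>F\<close> where they differ. As \<open>F\<close> goes from 0 to 1 the argument goes from
  \<open>x\<close> to \<open>y\<close>, and \<open>m\<close> falls.\<close>

lemma nonmono_neg:
  assumes act: "acts C S" and m: "m \<in> C" "m \<notin> Mono"
    and tt: "(\<lambda>_. True) \<in> S" and ff: "(\<lambda>_. False) \<in> S"
  shows "closed_neg S"
  unfolding closed_neg_def
proof
  fix F assume F: "F \<in> S"
  obtain x y where xy: "\<And>i. x i \<Longrightarrow> y i" "m x" "\<not> m y"
    using not_MonoE[OF m(2)] by blast
  have "(\<lambda>v. m (\<lambda>i. if x i then True else if y i then F v else False)) \<in> S"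
    by (rule acts_ternary[OF act m(1) tt F ff])
  moreover have "m (\<lambda>i. if x i then True else if y i then F v else False) = (\<not> F v)" for v
  proof (cases "F v")
    case True
    then have "(\<lambda>i. if x i then True else if y i then F v else False) = y" using xy(1) by (intro ext) auto
    then show ?thesis using True xy by simp
  next
    case False
    then have "(\<lambda>i. if x i then True else if y i then F v else False) = x" by (intro ext) auto
    then show ?thesis using False xy by simp
  qed
  ultimately show "(\<lambda>v. \<not> F v) \<in> S" by simp
qed

lemma const_neg:
  assumes act: "acts C S" and "f \<in> C" "f (\<lambda>_. False)" "\<not> f (\<lambda>_. True)"
  shows "closed_neg S"
  unfolding closed_neg_def
proof
  fix F assume F: "F \<in> S"
  have "(\<lambda>x. f (\<lambda>i. F x)) \<in> S" using acts_comp[OF act assms(2) F] by simp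
  moreover have "f (\<lambda>i. F x) = (\<not> F x)" for x using assms(3,4) by (cases "F x") auto
  ultimately show "(\<lambda>x. \<not> F x) \<in> S" by simp
qed

section \<open>Generation of the classes that are not affine\<close>

lemma SD_eqI:
  assumes "F \<in> SD" "G \<in> SD" "\<And>x. \<not> x 0 \<Longrightarrow> F x = G x"
  shows "F = G"
proof
  fix x show "F x = G x"
  proof (cases "x 0")
    case True
    then have "F (\<lambda>i. \<not> x i) = G (\<lambda>i. \<not> x i)" using assms(3) by simp
    then show ?thesis using assms(1,2) by (simp add: SD_def)
  qed (use assms in auto)
qed

text \<open>A member of \<open>C\<close> may depend on infinitely many variables. Redirecting those
  beyond \<open>n\<close> to variable 0, rather than to a constant, stays inside the clone, and
  makes the assignment constant as soon as it is constant up to \<open>n\<close>.\<close>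

lemma clone_trunc:
  assumes "clone C" "G \<in> C"
  shows "(\<lambda>x. G (\<lambda>i. if i \<le> n then x i else x 0)) \<in> C"
proof -
  have "(\<lambda>x. G (\<lambda>i. x (if i \<le> n then i else 0))) \<in> C"
    by (rule acts_comp[OF assms]) (rule acts_proj[OF assms(1)])
  moreover have "(\<lambda>x. G (\<lambda>i. x (if i \<le> n then i else 0))) = (\<lambda>x. G (\<lambda>i. if i \<le> n then x i else x 0))"
    by (rule ext, rule arg_cong[of _ _ G], rule ext) simp
  ultimately show ?thesis by simp
qed

lemma fin_trunc: "fin (Suc n) F \<Longrightarrow> F (\<lambda>i. if i \<le> n then x i else x 0) = F x"
  by (rule finD) auto

text \<open>The blocks \<open>a\<close> turn \<open>f\<close> into XOR, and \<open>l\<close> then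
  yields AND, hence OR. On \<open>X\<close> the disjunction of the variables is True, so all
  operations are available there; off \<open>X\<close> the truncated assignment is zero, where both
  functions are False.\<close>

lemma T0_gen:
  assumes C: "clone C" "C \<subseteq> T0"
    and f: "f \<in> C" "\<not> f (\<lambda>_. True)" "f a" "f (\<lambda>i. \<not> a i)"
    and l: "l \<in> C" "l \<notin> Aff"
    and F: "fin n F" "F \<in> T0"
  shows "F \<in> C"
proof -
  define X where "X = {x :: nat \<Rightarrow> bool. \<exists>i\<le>n. x i}"
  let ?S = "restr C X"
  have act: "acts C ?S" by (rule acts_restr[OF C(1)])
  note proj = acts_proj[OF act]
  have xor: "closed2 (\<noteq>) ?S"
    by (rule acts_binop_eq[OF act f(1), of _ a]) (use f C(2) in \<open>auto simp: T0_def\<close>)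
  have ff: "(\<lambda>_. False) \<in> ?S" using closed2D[OF xor proj[of 0] proj[of 0]] by simp
  have conj: "closed2 (\<and>) ?S"
    by (rule nonadditive_and[OF act l(1) _ l(2) ff xor]) (use l C in auto)
  have tt: "(\<lambda>_. True) \<in> ?S"
    by (rule restr_cong[OF closed_big_or[OF proj or_of_xor_and[OF xor conj], of n]]) (simp add: X_def)
  have "F \<in> ?S"
    by (rule fin_in_closed[OF proj tt ff conj closed_neg_of_xor[OF xor tt] F(1)])
  then obtain G where G: "G \<in> C" "\<And>x. x \<in> X \<Longrightarrow> F x = G x" by (auto simp: restr_def)
  have "F x = G (\<lambda>i. if i \<le> n then x i else x 0)" for x
  proof -
    let ?x = "\<lambda>i. if i \<le> n then x i else x 0"
    have "F x = F ?x" by (rule fin_trunc[symmetric]) (use fin_mono[OF F(1)] in simp)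
    also have "\<dots> = G ?x"
    proof (cases "?x \<in> X")
      case False
      then have "?x = (\<lambda>_. False)" by (auto simp: X_def)
      moreover have "F (\<lambda>_. False) = G (\<lambda>_. False)" using F(2) C(2) G(1) by (auto simp: T0_def)
      ultimately show ?thesis by (simp only:)
    qed (rule G(2))
    finally show ?thesis .
  qed
  then have "F = (\<lambda>x. G (\<lambda>i. if i \<le> n then x i else x 0))" by (rule ext)
  then show ?thesis using clone_trunc[OF C(1) G(1), of n] by (simp only:)
qed

text \<open>The same \<open>h\<close> gives OR along \<open>a\<close> and AND along
  \<open>b\<close>. These produce both constants on the nonconstant assignments, and only then can
  \<open>m\<close> supply negation.\<close>

lemma T01_gen:
  assumes C: "clone C" "C \<subseteq> T0 \<inter> T1"
    and h: "h \<in> C" "h a" "h (\<lambda>i. \<not> a i)" "\<not> h b" "\<not> h (\<lambda>i. \<not> b i)"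
    and m: "m \<in> C" "m \<notin> Mono"
    and F: "fin n F" "F \<in> T0" "F \<in> T1"
  shows "F \<in> C"
proof -
  define X where "X = {x :: nat \<Rightarrow> bool. (\<exists>i\<le>n. x i) \<and> (\<exists>i\<le>n. \<not> x i)}"
  let ?S = "restr C X"
  have act: "acts C ?S" by (rule acts_restr[OF C(1)])
  note proj = acts_proj[OF act]
  have disj: "closed2 (\<or>) ?S"
    by (rule acts_binop_eq[OF act h(1), of _ a]) (use h C(2) in \<open>auto simp: T0_def T1_def\<close>)
  have conj: "closed2 (\<and>) ?S"
    by (rule acts_binop_eq[OF act h(1), of _ b]) (use h C(2) in \<open>auto simp: T0_def T1_def\<close>)
  have tt: "(\<lambda>_. True) \<in> ?S"
    by (rule restr_cong[OF closed_big_or[OF proj disj, of n]]) (simp add: X_def)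
  have ff: "(\<lambda>_. False) \<in> ?S"
    by (rule restr_cong[OF closed_big_and[OF proj conj, of n]]) (auto simp add: X_def)
  have "F \<in> ?S"
    by (rule fin_in_closed[OF proj tt ff conj nonmono_neg[OF act m tt ff] F(1)])
  then obtain G where G: "G \<in> C" "\<And>x. x \<in> X \<Longrightarrow> F x = G x" by (auto simp: restr_def)
  have "F x = G (\<lambda>i. if i \<le> n then x i else x 0)" for x
  proof -
    let ?x = "\<lambda>i. if i \<le> n then x i else x 0"
    have "F x = F ?x" by (rule fin_trunc[symmetric]) (use fin_mono[OF F(1)] in simp)
    also have "\<dots> = G ?x"
    proof (cases "?x \<in> X")
      case False
      then have "?x = (\<lambda>_. False) \<or> ?x = (\<lambda>_. True)" by (auto simp: X_def)
      moreover have "F (\<lambda>_. False) = G (\<lambda>_. False)" "F (\<lambda>_. True) = G (\<lambda>_. True)"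
        using F(2,3) C(2) G(1) by (auto simp: T0_def T1_def)
      ultimately show ?thesis by (elim disjE) (simp_all only:)
    qed (rule G(2))
    finally show ?thesis .
  qed
  then have "F = (\<lambda>x. G (\<lambda>i. if i \<le> n then x i else x 0))" by (rule ext)
  then show ?thesis using clone_trunc[OF C(1) G(1), of n] by (simp only:)
qed

text \<open>Where variable 0 is False it serves as a constant; on the diagonal \<open>f\<close> is
  negation, and \<open>l\<close> gives conjunction. Self-duality recovers the other half of the
  cube.\<close>

lemma SD_gen:
  assumes C: "clone C" "C \<subseteq> SD"
    and f: "f \<in> C" "f \<notin> T0"
    and l: "l \<in> C" "l \<notin> Aff"
    and F: "fin n F" "F \<in> SD"
  shows "F \<in> C"
proof -
  let ?S = "restr C {x. \<not> x 0}"
  have act: "acts C ?S" by (rule acts_restr[OF C(1)])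
  have "f (\<lambda>_. False)" using f by (simp add: T0_def)
  moreover have "f (\<lambda>_. True) = (\<not> f (\<lambda>_. False))"
    using SDD[of f "\<lambda>_. False"] f(1) C(2) by auto
  ultimately have neg: "closed_neg ?S"
    by (intro const_neg[OF act f(1)]) auto
  have ff: "(\<lambda>_. False) \<in> ?S"
    by (rule restr_cong[OF acts_proj[OF act, of 0]]) simp
  have tt: "(\<lambda>_. True) \<in> ?S" using closed_negD[OF neg ff] by simp
  have "F \<in> ?S"
    by (rule fin_in_closed[OF acts_proj[OF act] tt ff nonaffine_and[OF act l tt ff neg] neg F(1)])
  then obtain G where G: "G \<in> C" "\<And>x. \<not> x 0 \<Longrightarrow> F x = G x" by (auto simp: restr_def)
  have "F = G" by (rule SD_eqI[OF F(2) _ G(2)]) (use G C in auto)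
  then show ?thesis using G by simp
qed

text \<open>All members fix both constant assignments, so no diagonal is a negation. Negation is
  instead XOR with True, where False is variable 0 and True is the disjunction of the variables on
  \<open>X\<close>.\<close>

lemma SD_T0_gen:
  assumes C: "clone C" "C \<subseteq> T0 \<inter> SD"
    and m: "m \<in> C" "m \<notin> Mono"
    and l: "l \<in> C" "l \<notin> Aff"
    and F: "fin n F" "F \<in> T0" "F \<in> SD"
  shows "F \<in> C"
proof -
  define X where "X = {x :: nat \<Rightarrow> bool. \<not> x 0 \<and> (\<exists>i\<le>n. x i)}"
  let ?S = "restr C X"
  have act: "acts C ?S" by (rule acts_restr[OF C(1)])
  note proj = acts_proj[OF act]
  have ff: "(\<lambda>_. False) \<in> ?S"
    by (rule restr_cong[OF proj[of 0]]) (simp add: X_def)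
  obtain x y where xy: "\<And>i. x i \<Longrightarrow> y i" "m x" "\<not> m y"
    using not_MonoE[OF m(2)] by blast
  define h where "h p q r = m (\<lambda>i. if x i then p else if y i then q else r)" for p q r
  have hS: "(\<lambda>v. h (P v) (Q v) (R v)) \<in> ?S" if "P \<in> ?S" "Q \<in> ?S" "R \<in> ?S" for P Q R
    unfolding h_def by (rule acts_ternary[OF act m(1) that])
  have hd: "h (\<not> p) (\<not> q) (\<not> r) = (\<not> h p q r)" for p q r
  proof -
    have "(\<lambda>i. if x i then \<not> p else if y i then \<not> q else \<not> r) =
        (\<lambda>i. \<not> (if x i then p else if y i then q else r))" by (intro ext) auto
    moreover have "m \<in> SD" using m(1) C(2) by blast
    ultimately show ?thesis unfolding h_def by (rule trans[OF arg_cong[of _ _ m] SDD])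
  qed
  have h0: "\<not> h False False False" unfolding h_def using m(1) C(2) by (auto simp: T0_def)
  have h1: "h True False False"
  proof -
    have "(\<lambda>i. if x i then True else if y i then False else False) = x" by (intro ext) auto
    then show ?thesis unfolding h_def using xy by simp
  qed
  have h2: "\<not> h True True False"
  proof -
    have "(\<lambda>i. if x i then True else if y i then True else False) = y" using xy(1) by (intro ext) auto
    then show ?thesis unfolding h_def using xy by simp
  qed
  have op1: "closed2 (\<lambda>p q. h p q False) ?S" and op2: "closed2 (\<lambda>p q. h p False q) ?S"
    unfolding closed2_def by (intro ballI hS ff; assumption)+
  \<comment> \<open>The values of \<open>h\<close> at 000, 100 and 110 are 0, 1 and 0. The value at
    010 decides whether the face r = 0 is XOR or \<open>p \<and> \<not> q\<close>. In the second
    case self-duality makes the face q = 0 a disjunction, and the two together express AND and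
    XOR.\<close>
  have "closed2 (\<noteq>) ?S \<and> closed2 (\<and>) ?S"
  proof (cases "h False True False")
    case True
    have "h p q False = (p \<noteq> q)" for p q
      using h0 h1 h2 True by (cases p; cases q) auto
    then have xor: "closed2 (\<noteq>) ?S" using op1 by simp
    then show ?thesis using nonadditive_and[OF act l(1) _ l(2) ff xor] l C by auto
  next
    case False
    have e1: "h p q False = (p \<and> \<not> q)" for p q
      using h0 h1 h2 False by (cases p; cases q) auto
    have e2: "h p False q = (p \<or> q)" for p q
      using h0 h1 h2 False hd[of False True False] hd[of True True False] by (cases p; cases q) auto
    have d: "closed2 (\<lambda>p q. p \<and> \<not> q) ?S" and o: "closed2 (\<or>) ?S"
      using op1 op2 by (simp_all add: e1 e2)
    have 1: "(\<lambda>x. P x \<and> \<not> (P x \<and> \<not> Q x)) \<in> ?S" and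
      2: "(\<lambda>x. (P x \<and> \<not> Q x) \<or> (Q x \<and> \<not> P x)) \<in> ?S"
      if "P \<in> ?S" "Q \<in> ?S" for P Q
      by (intro closed2D[OF d] closed2D[OF o] that)+
    have "(\<lambda>x. P x \<and> Q x) \<in> ?S" if "P \<in> ?S" "Q \<in> ?S" for P Q
      by (rule mem_ext[OF 1[OF that]]) blast
    moreover have "(\<lambda>x. P x \<noteq> Q x) \<in> ?S" if "P \<in> ?S" "Q \<in> ?S" for P Q
      by (rule mem_ext[OF 2[OF that]]) blast
    ultimately show ?thesis by (simp add: closed2_def)
  qed
  then have xor: "closed2 (\<noteq>) ?S" and conj: "closed2 (\<and>) ?S" by auto
  have tt: "(\<lambda>_. True) \<in> ?S"
    by (rule restr_cong[OF closed_big_or[OF proj or_of_xor_and[OF xor conj], of n]]) (simp add: X_def)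
  have "F \<in> ?S"
    by (rule fin_in_closed[OF proj tt ff conj closed_neg_of_xor[OF xor tt] F(1)])
  then obtain G where G: "G \<in> C" "\<And>x. x \<in> X \<Longrightarrow> F x = G x" by (auto simp: restr_def)
  let ?G = "\<lambda>x. G (\<lambda>i. if i \<le> n then x i else x 0)"
  have GC: "?G \<in> C" by (rule clone_trunc[OF C(1) G(1)])
  have "F = ?G"
  proof (rule SD_eqI[OF F(3)])
    show "?G \<in> SD" using GC C(2) by blast
  next
    fix x :: "nat \<Rightarrow> bool" assume x: "\<not> x 0"
    let ?x = "\<lambda>i. if i \<le> n then x i else x 0"
    have "F x = F ?x" by (rule fin_trunc[symmetric]) (use fin_mono[OF F(1)] in simp)
    also have "\<dots> = G ?x"
    proof (cases "?x \<in> X")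
      case False
      then have "?x = (\<lambda>_. False)" using x by (auto simp: X_def)
      moreover have "F (\<lambda>_. False) = G (\<lambda>_. False)" using F(2) C(2) G(1) by (auto simp: T0_def)
      ultimately show ?thesis by (simp only:)
    qed (rule G(2))
    finally show "F x = ?G x" .
  qed
  then show ?thesis using GC by simp
qed

lemma UNIV_gen:
  assumes C: "clone C"
    and f: "f \<in> C" "f \<notin> T0" and g: "g \<in> C" "g \<notin> T1" and h: "h \<in> C" "h \<notin> SD"
    and l: "l \<in> C" "l \<notin> Aff" and m: "m \<in> C" "m \<notin> Mono"
    and F: "fin n F"
  shows "F \<in> C"
proof -
  note proj = acts_proj[OF C]
  have f0: "f (\<lambda>_. False)" and g1: "\<not> g (\<lambda>_. True)" using f g by (auto simp: T0_def T1_def)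
  have "(\<lambda>_. True) \<in> C \<and> (\<lambda>_. False) \<in> C \<and> closed_neg C"
  \<comment> \<open>On the diagonal each of \<open>f\<close> and \<open>g\<close> is either a
    constant or negation; the first case is that both are constants.\<close>
  proof (cases "f (\<lambda>_. True) \<and> \<not> g (\<lambda>_. False)")
    case True
    have "f (\<lambda>_. b)" "\<not> g (\<lambda>_. b)" for b using True f0 g1 by (cases b; simp)+
    moreover have "(\<lambda>x. f (\<lambda>_. x 0)) \<in> C" "(\<lambda>x. g (\<lambda>_. x 0)) \<in> C"
      by (rule acts_comp[OF C f(1) proj], rule acts_comp[OF C g(1) proj])
    ultimately have "(\<lambda>_. True) \<in> C" "(\<lambda>_. False) \<in> C" by simp_all
    then show ?thesis using nonmono_neg[OF C m] by auto
  next
    case False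
    then have neg: "closed_neg C"
      using const_neg[OF C f(1) f0] const_neg[OF C g(1) _ g1] by auto
    obtain a where a: "h (\<lambda>i. \<not> a i) = h a" using h(2) by (auto simp: SD_def)
    \<comment> \<open>With negation at hand, a pair of antipodal points on which \<open>h\<close>
      agrees turns into a constant function.\<close>
    have "(\<lambda>x. h (\<lambda>i. if a i then x 0 else \<not> x 0)) \<in> C"
      by (rule closed2D[OF acts_binop[OF C h(1)] proj closed_negD[OF neg proj]])
    moreover have "h (\<lambda>i. if a i then b else \<not> b) = h a" for b
      using a by (cases b) simp_all
    ultimately have "(\<lambda>_. h a) \<in> C" by simp
    moreover from closed_negD[OF neg this] have "(\<lambda>_. \<not> h a) \<in> C" .
    ultimately show ?thesis using neg by (cases "h a") auto
  qed
  then show ?thesis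
    using fin_in_closed[OF proj _ _ nonaffine_and[OF C l]] F by blast
qed

section \<open>Generation of the affine classes\<close>

lemma Aff_T0_gen:
  assumes C: "clone C"
    and f: "f \<in> C" "\<not> f (\<lambda>_. False)" "\<not> f (\<lambda>_. True)" "f a" "f (\<lambda>i. \<not> a i)"
    and F: "fin n F" "F \<in> T0" "F \<in> Aff"
  shows "F \<in> C"
proof -
  have xor: "closed2 (\<noteq>) C"
    by (rule acts_binop_eq[OF C f(1), of _ a]) (use f in auto)
  have ff: "(\<lambda>_. False) \<in> C"
    using closed2D[OF xor acts_proj[OF C, of 0] acts_proj[OF C, of 0]] by simp
  show ?thesis by (rule fin_Aff_in_closed[OF acts_proj[OF C] ff xor F(1,3,2)])
qed

lemma in_via_neg:
  assumes "closed_neg C" "(\<lambda>x. \<not> F x) \<in> C"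
  shows "F \<in> C"
  using closed_negD[OF assms] by simp

text \<open>Affinity and the antipodal pair \<open>a\<close> force \<open>h\<close> to agree at the
  two constants. If that common value is 0, the blocks \<open>a\<close> give XOR; if it is 1, the
  blocks \<open>b\<close> give equivalence. Each yields one constant, and \<open>f\<close> or
  \<open>g\<close> turns it into the other.\<close>

lemma Aff_gen:
  assumes C: "clone C" "C \<subseteq> Aff"
    and f: "f \<in> C" "f \<notin> T0" and g: "g \<in> C" "g \<notin> T1"
    and h: "h \<in> C" "h a" "h (\<lambda>i. \<not> a i)" "\<not> h b" "\<not> h (\<lambda>i. \<not> b i)"
    and F: "fin n F" "F \<in> Aff"
  shows "F \<in> C"
proof -
  note proj = acts_proj[OF C(1)]
  have f0: "f (\<lambda>_. False)" and g1: "\<not> g (\<lambda>_. True)" using f g by (auto simp: T0_def T1_def)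
  have "h \<in> Aff" using h(1) C(2) by blast
  from AffD[OF this, of a "\<lambda>i. \<not> a i" "\<lambda>_. False"]
  have eq: "h (\<lambda>_. True) = h (\<lambda>_. False)" using h by simp
  have *: "(\<lambda>_. True) \<in> C \<and> (\<lambda>_. False) \<in> C \<and> closed2 (\<noteq>) C"
  proof (cases "h (\<lambda>_. False)")
    case False
    have xor: "closed2 (\<noteq>) C"
      by (rule acts_binop_eq[OF C(1) h(1), of _ a]) (use h eq False in auto)
    have ff: "(\<lambda>_. False) \<in> C" using closed2D[OF xor proj[of 0] proj[of 0]] by simp
    have "(\<lambda>_. f (\<lambda>_. False)) \<in> C" using acts_comp[OF C(1) f(1) ff] by simp
    then show ?thesis using xor ff f0 by simp
  next
    case True
    have iff: "closed2 (=) C"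
      by (rule acts_binop_eq[OF C(1) h(1), of _ b]) (use h eq True in auto)
    have tt: "(\<lambda>_. True) \<in> C" using closed2D[OF iff proj[of 0] proj[of 0]] by simp
    have "(\<lambda>_. g (\<lambda>_. True)) \<in> C" using acts_comp[OF C(1) g(1) tt] by simp
    then have ff: "(\<lambda>_. False) \<in> C" using g1 by simp
    have "closed2 (\<noteq>) C"
      unfolding closed2_def using closed2D[OF iff closed2D[OF iff _ _] ff] by simp
    then show ?thesis using tt ff by simp
  qed
  then have neg: "closed_neg C" using closed_neg_of_xor by blast
  have gen: "G \<in> C" if "fin n G" "G \<in> Aff" "G \<in> T0" for G
    using fin_Aff_in_closed[OF proj _ _ that] * by blast
  show ?thesis
  proof (cases "F \<in> T0")
    case False
    show ?thesis
      by (rule in_via_neg[OF neg gen[OF fin_neg[OF F(1)] Aff_neg[OF F(2)]]]) (use False in \<open>auto simp: T0_def\<close>)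
  qed (rule gen[OF F])
qed

text \<open>A linear form vanishes if it does so on the unit vectors. Finite arity is essential,
  since unit vectors span only the assignments of finite support.\<close>

lemma Aff_T0_zero:
  "fin n F \<Longrightarrow> F \<in> Aff \<Longrightarrow> F \<in> T0 \<Longrightarrow> (\<And>i. \<not> F (\<lambda>k. k = i)) \<Longrightarrow> \<not> F x"
proof (induction n arbitrary: x F)
  case 0 then show ?case using fin_0[of F] by (auto simp: T0_def)
next
  case (Suc n)
  have "\<not> F ((\<lambda>k. k = i)(n := False))" for i
    using Aff_T0_split[OF Suc.prems(2,3), of "\<lambda>k. k = i" n] Suc.prems(4)[of i] Suc.prems(4)[of n] by blast
  then have "\<not> F (x(n := False))"
    using Suc.IH[OF fin_upd[OF Suc.prems(1)], of False x] Aff_T0_upd[OF Suc.prems(2,3)] by blast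
  then show ?case using Aff_T0_split[OF Suc.prems(2,3), of x n] Suc.prems(4)[of n] by blast
qed

text \<open>\<open>g\<close> is a sum of variables and takes the value 1 at the all-True assignment;
  not being a projection, it has more than one summand. Keeping two of them and setting the others
  to variable 0, which is False on the half cube, leaves XOR.\<close>

lemma odd_sum_gen:
  assumes C: "clone C" "C \<subseteq> SD"
    and g: "g \<in> C" "g \<in> Aff" "g \<in> T0" "g \<notin> Proj" "fin k g"
    and F: "fin n F" "F \<in> T0" "F \<in> SD" "F \<in> Aff"
  shows "F \<in> C"
proof -
  note add = Aff_T0_add[OF g(2,3)]
  have "g (\<lambda>_. True) = (\<not> g (\<lambda>_. False))"
    using SDD[of g "\<lambda>_. False"] g(1) C(2) by auto
  then have g1: "g (\<lambda>_. True)" using g(3) by (simp add: T0_def)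
  then obtain i where i: "g (\<lambda>k. k = i)" using Aff_T0_zero[OF g(5,2,3)] by blast
  \<comment> \<open>Otherwise \<open>g\<close> plus variable \<open>i\<close> vanishes on all unit
    vectors, hence everywhere, and \<open>g\<close> is a projection.\<close>
  have "\<exists>j. j \<noteq> i \<and> g (\<lambda>k. k = j)"
  proof (rule ccontr)
    assume none: "\<not> ?thesis"
    let ?g = "\<lambda>x. g x \<noteq> x i"
    have A: "?g \<in> Aff \<inter> T0"
    proof (rule Aff_T0I)
      fix x y
      show "?g (\<lambda>k. x k \<noteq> y k) = (?g x \<noteq> ?g y)" using add[of x y] by blast
    qed
    have "fin (max k (Suc i)) ?g"
    proof (rule finI)
      fix x y :: "nat \<Rightarrow> bool" assume eq: "\<And>l. l < max k (Suc i) \<Longrightarrow> x l = y l"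
      have "g x = g y" by (rule finD[OF g(5)]) (simp add: eq)
      moreover have "x i = y i" by (rule eq) simp
      ultimately show "(g x \<noteq> x i) = (g y \<noteq> y i)" by simp
    qed
    then have "\<not> ?g x" for x
      by (rule Aff_T0_zero) (use A none i in auto)
    then have "g = (\<lambda>x. x i)" by auto
    then show False using g(4) by (auto simp: Proj_def)
  qed
  then obtain j where j: "j \<noteq> i" "g (\<lambda>k. k = j)" by blast
  let ?S = "restr C {x. \<not> x 0}"
  have act: "acts C ?S" by (rule acts_restr[OF C(1)])
  have ff: "(\<lambda>_. False) \<in> ?S"
    by (rule restr_cong[OF acts_proj[OF act, of 0]]) simp
  have eq: "g (\<lambda>k. if k = i then p else if k = j then q else False) = (p \<noteq> q)" for p q
  proof -
    have "(\<lambda>k. if k = i then p else if k = j then q else False) = (\<lambda>k. (k = i \<and> p) \<noteq> (k = j \<and> q))"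
      using j(1) by (intro ext) auto
    moreover have "g (\<lambda>k. k = i \<and> p) = p" "g (\<lambda>k. k = j \<and> q) = q"
      using i j(2) g(3) by (cases p; cases q; simp add: T0_def)+
    ultimately show ?thesis
      using add[of "\<lambda>k. k = i \<and> p" "\<lambda>k. k = j \<and> q"] by (simp only:)
  qed
  have xor: "closed2 (\<noteq>) ?S"
    unfolding closed2_def
    using acts_ternary[OF act g(1) _ _ ff, of _ _ "\<lambda>k. k = i" "\<lambda>k. k = j"] by (simp add: eq)
  have "F \<in> ?S"
    by (rule fin_Aff_in_closed[OF acts_proj[OF act] ff xor F(1,4,2)])
  then obtain G where G: "G \<in> C" "\<And>x. \<not> x 0 \<Longrightarrow> F x = G x" by (auto simp: restr_def)
  have "F = G" by (rule SD_eqI[OF F(3) _ G(2)]) (use G C in auto)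
  then show ?thesis using G by simp
qed

text \<open>\<open>f\<close> provides negation, and negating where necessary brings both
  \<open>g\<close> and \<open>F\<close> into \<open>T0\<close>, which reduces the claim to
  \<open>odd_sum_gen\<close>.\<close>

lemma SD_Aff_gen:
  assumes C: "clone C" "C \<subseteq> SD \<inter> Aff"
    and f: "f \<in> C" "f \<notin> T0"
    and g: "g \<in> C" "g \<notin> Lit" "fin k g"
    and F: "fin n F" "F \<in> SD" "F \<in> Aff"
  shows "F \<in> C"
proof -
  have "f (\<lambda>_. False)" using f by (simp add: T0_def)
  moreover have "f (\<lambda>_. True) = (\<not> f (\<lambda>_. False))"
    using SDD[of f "\<lambda>_. False"] f(1) C(2) by auto
  ultimately have neg: "closed_neg C"
    by (intro const_neg[OF C(1) f(1)]) auto
  have "\<exists>g'\<in>C. g' \<in> T0 \<and> g' \<notin> Proj \<and> fin k g'"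
  proof (cases "g \<in> T0")
    case True then show ?thesis using g by (auto simp: Lit_def)
  next
    case False
    have "(\<lambda>x. \<not> g x) \<notin> Proj"
    proof
      assume "(\<lambda>x. \<not> g x) \<in> Proj"
      then obtain i where i: "(\<lambda>x. \<not> g x) = (\<lambda>x. x i)" unfolding Proj_def by (rule rangeE)
      have "g x = (\<not> x i)" for x using fun_cong[OF i, of x] by blast
      then have "g = (\<lambda>x. \<not> x i)" by (rule ext)
      then show False using g(2) by (auto simp: Lit_def)
    qed
    then show ?thesis
      using False closed_negD[OF neg g(1)] fin_neg[OF g(3)] by (auto simp: T0_def)
  qed
  then obtain g' where g': "g' \<in> C" "g' \<in> T0" "g' \<notin> Proj" "fin k g'" by blast
  have gen: "G \<in> C" if "fin n G" "G \<in> T0" "G \<in> SD" "G \<in> Aff" for G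
    using odd_sum_gen[OF C(1) _ g'(1) _ g'(2-4) that] C(2) g'(1) by blast
  show ?thesis
  proof (cases "F \<in> T0")
    case False
    show ?thesis
      by (rule in_via_neg[OF neg gen[OF fin_neg[OF F(1)] _ SD_neg[OF F(2)] Aff_neg[OF F(3)]]])
        (use False in \<open>auto simp: T0_def\<close>)
  qed (rule gen[OF F(1) _ F(2,3)])
qed

section \<open>Duality, which carries the results on \<open>T0\<close> over to
  \<open>T1\<close>\<close>

definition dual :: "bfun \<Rightarrow> bfun" where
  "dual F = (\<lambda>x. \<not> F (\<lambda>i. \<not> x i))"

lemma dual_dual [simp]: "dual (dual F) = F"
  by (simp add: dual_def)

lemma dual_in_image [simp]: "dual F \<in> dual ` C \<longleftrightarrow> F \<in> C"
  by (metis dual_dual image_iff)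

lemma in_dual_image: "F \<in> dual ` C \<longleftrightarrow> dual F \<in> C"
  by (metis dual_dual image_iff)

lemma clone_dual:
  assumes "clone C"
  shows "clone (dual ` C)"
  unfolding acts_def
proof (intro conjI allI ballI impI)
  fix i show "(\<lambda>x. x i) \<in> dual ` C"
    unfolding in_dual_image using acts_proj[OF assms, of i] by (simp add: dual_def)
next
  fix H and G :: "nat \<Rightarrow> bfun" assume "H \<in> dual ` C" and "\<forall>i. G i \<in> dual ` C"
  then have HG: "dual H \<in> C" "\<And>i. dual (G i) \<in> C" by (simp_all add: in_dual_image)
  have "(\<lambda>x. dual H (\<lambda>i. dual (G i) x)) \<in> C"
    by (rule acts_comp[OF assms HG])
  then show "(\<lambda>x. H (\<lambda>i. G i x)) \<in> dual ` C"
    unfolding in_dual_image by (simp add: dual_def)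
qed

lemma dual_T0: "dual F \<in> T0 \<longleftrightarrow> F \<in> T1"
  by (simp add: dual_def T0_def T1_def)

lemma dual_Aff: "F \<in> Aff \<Longrightarrow> dual F \<in> Aff"
proof -
  assume "F \<in> Aff"
  then have "F (\<lambda>i. (\<not> x i) \<noteq> ((\<not> y i) \<noteq> (\<not> z i))) = (F (\<lambda>i. \<not> x i) \<noteq> (F (\<lambda>i. \<not> y i) \<noteq> F (\<lambda>i. \<not> z i)))" for x y z
    by (rule AffD)
  moreover have "(\<lambda>i. (\<not> x i) \<noteq> ((\<not> y i) \<noteq> (\<not> z i))) = (\<lambda>i. \<not> (x i \<noteq> (y i \<noteq> z i)))" for x y z :: "nat \<Rightarrow> bool"
    by (intro ext) auto
  ultimately show ?thesis unfolding Aff_def dual_def by auto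
qed

lemma dual_fin: "fin n F \<Longrightarrow> fin n (dual F)"
  unfolding fin_def dual_def by simp

lemma T1_gen:
  assumes C: "clone C" "C \<subseteq> T1"
    and f: "f \<in> C" "f (\<lambda>_. False)" "\<not> f a" "\<not> f (\<lambda>i. \<not> a i)"
    and l: "l \<in> C" "l \<notin> Aff"
    and F: "fin n F" "F \<in> T1"
  shows "F \<in> C"
proof -
  have "dual F \<in> dual ` C"
  proof (rule T0_gen[OF clone_dual[OF C(1)], of "dual f" a "dual l"])
    show "dual ` C \<subseteq> T0" using C(2) dual_T0 by blast
    show "dual l \<notin> Aff" using l(2) dual_Aff[of "dual l"] by auto
  qed (use f l F dual_T0 dual_fin in \<open>auto simp: dual_def\<close>)
  then show ?thesis by simp
qed

lemma Aff_T1_gen: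
  assumes C: "clone C"
    and f: "f \<in> C" "f (\<lambda>_. False)" "f (\<lambda>_. True)" "\<not> f a" "\<not> f (\<lambda>i. \<not> a i)"
    and F: "fin n F" "F \<in> T1" "F \<in> Aff"
  shows "F \<in> C"
proof -
  have "dual F \<in> dual ` C"
    by (rule Aff_T0_gen[OF clone_dual[OF C(1)], of "dual f" a])
      (use f F dual_T0 dual_fin dual_Aff in \<open>auto simp: dual_def\<close>)
  then show ?thesis by simp
qed

text \<open>The sets on which \<open>F\<close> is True form an ultrafilter on the indices. Finite
  arity makes it principal: otherwise all complements of points belong to it, and intersecting the
  first \<open>n\<close> of them gives a set that \<open>F\<close> cannot tell from the empty
  one.\<close>

lemma lattice_hom_Proj:
  assumes "fin n F" and conj: "\<And>x y. F (\<lambda>i. x i \<and> y i) = (F x \<and> F y)" and "F \<in> SD"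
  shows "F \<in> Proj"
proof -
  have neg: "F (\<lambda>i. \<not> x i) = (\<not> F x)" for x using assms(3) by (simp add: SD_def)
  have F0: "\<not> F (\<lambda>_. False)"
    using conj[of "\<lambda>_. True" "\<lambda>_. False"] neg[of "\<lambda>_. True"] by simp
  have "\<exists>i. F (\<lambda>k. k = i)"
  proof (rule ccontr)
    assume "\<nexists>i. F (\<lambda>k. k = i)"
    then have e: "F (\<lambda>k. k \<noteq> i)" for i using neg[of "\<lambda>k. k = i"] by simp
    have "F (\<lambda>k. \<not> k < m)" for m
    proof (induction m)
      case 0 then show ?case using neg[of "\<lambda>_. False"] F0 by simp
    next
      case (Suc m)
      have "F (\<lambda>k. \<not> k < m \<and> k \<noteq> m)" using Suc e conj by simp
      moreover have "(\<lambda>k. \<not> k < m \<and> k \<noteq> m) = (\<lambda>k. \<not> k < Suc m)" by (intro ext) auto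
      ultimately show ?case by simp
    qed
    moreover have "F (\<lambda>k. \<not> k < n) = F (\<lambda>_. False)" by (rule finD[OF assms(1)]) simp
    ultimately show False using F0 by simp
  qed
  then obtain i where i: "F (\<lambda>k. k = i)" by blast
  have "F x = x i" for x
  proof -
    have "(\<lambda>k. k = i \<and> x k) = (if x i then (\<lambda>k. k = i) else (\<lambda>_. False))" by (intro ext) auto
    then show ?thesis using conj[of "\<lambda>k. k = i" x] i F0 by (simp split: if_splits)
  qed
  then show ?thesis by (auto simp: Proj_def)
qed

section \<open>Coordinates of permutations\<close>

declare One_nat_def [simp del]

definition enc :: "nat \<Rightarrow> (nat \<Rightarrow> bool) \<Rightarrow> nat list" where
  "enc n x = map (\<lambda>i. of_bool (x i)) [0..<n]"

text \<open>Meaningful for \<open>j < fst P\<close> only, as the list has no further entries; every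
  use must respect this bound.\<close>

definition crd :: "nat pmap \<Rightarrow> nat \<Rightarrow> bfun" where
  "crd P j = (\<lambda>x. snd P (enc (fst P) x) ! j = 1)"

definition Bij :: "bfun set \<Rightarrow> nat pmap set" where
  "Bij K = {P \<in> BA {0, 1}. \<forall>j < fst P. crd P j \<in> K}"

text \<open>\<open>M i\<close> is row \<open>i\<close> of an array with infinitely many columns,
  matching the assignments.\<close>

definition pol :: "nat \<Rightarrow> nat list set \<Rightarrow> bfun set" where
  "pol k R = {F. \<forall>M. (\<forall>j. enc k (\<lambda>i. M i j) \<in> R) \<longrightarrow> enc k (\<lambda>i. F (M i)) \<in> R}"

abbreviation bits :: "nat \<Rightarrow> nat list set" where
  "bits n \<equiv> nlists n {0, 1}"

lemma length_enc [simp]: "length (enc n x) = n"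
  by (simp add: enc_def)

lemma nth_enc [simp]: "i < n \<Longrightarrow> enc n x ! i = of_bool (x i)"
  by (simp add: enc_def)

lemma enc_bits [simp]: "enc n x \<in> bits n"
  by (rule nlistsI) (simp_all add: enc_def image_subset_iff of_bool_def)

lemma enc_cong: "(\<And>i. i < n \<Longrightarrow> x i = y i) \<Longrightarrow> enc n x = enc n y"
  by (simp add: enc_def)

lemma bits_nth: "xs \<in> bits n \<Longrightarrow> i < n \<Longrightarrow> xs ! i = of_bool (xs ! i = 1)"
  using nlistsE_nth_in[of xs n "{0, 1}" i] by auto

lemma enc_nth: "xs \<in> bits n \<Longrightarrow> enc n (\<lambda>i. xs ! i = 1) = xs"
  using bits_nth[of xs n] by (intro nth_equalityI) simp_all

lemma bits_encE:
  assumes "xs \<in> bits n"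
  obtains x where "xs = enc n x"
  using enc_nth[OF assms, symmetric] by (rule that)

lemma finite_nlists: "finite A \<Longrightarrow> finite (nlists n A)"
  unfolding nlists_def using finite_lists_length_eq[of A n] by (simp add: conj_commute)

lemma finite_bits: "finite (bits n)"
  by (simp add: finite_nlists)

lemma mem_BA: "P \<in> BA A \<longleftrightarrow> snd P permutes nlists (fst P) A"
  by (cases P) (auto simp: BA_def Bn_def)

lemma BA_enc: "P \<in> BA {0, 1} \<Longrightarrow> snd P (enc (fst P) x) \<in> bits (fst P)"
  by (simp add: mem_BA permutes_in_image)

lemma BA_apply_enc:
  assumes "P \<in> BA {0, 1}"
  shows "snd P (enc (fst P) x) = enc (fst P) (\<lambda>j. crd P j x)"
  using enc_nth[OF BA_enc[OF assms, of x]] by (simp add: crd_def)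

lemma crd_fin: "fin (fst P) (crd P j)"
proof (rule finI)
  fix x y :: "nat \<Rightarrow> bool" assume "\<And>i. i < fst P \<Longrightarrow> x i = y i"
  then have "enc (fst P) x = enc (fst P) y" by (rule enc_cong)
  then show "crd P j x = crd P j y" by (simp add: crd_def)
qed

lemma clone_pol: "clone (pol k R)"
  unfolding acts_def
proof (intro conjI allI ballI impI)
  fix i show "(\<lambda>x. x i) \<in> pol k R" by (simp add: pol_def)
next
  fix H and G :: "nat \<Rightarrow> bfun"
  assume H: "H \<in> pol k R" and G: "\<forall>i. G i \<in> pol k R"
  show "(\<lambda>x. H (\<lambda>i. G i x)) \<in> pol k R"
    unfolding pol_def
  proof (intro CollectI allI impI)
    fix M :: "nat \<Rightarrow> nat \<Rightarrow> bool" assume M: "\<forall>j. enc k (\<lambda>i. M i j) \<in> R"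
    have "\<forall>l. enc k (\<lambda>i. G l (M i)) \<in> R" using G M by (simp add: pol_def)
    then show "enc k (\<lambda>i. H (\<lambda>l. G l (M i))) \<in> R"
      using H unfolding pol_def mem_Collect_eq by (elim allE[of _ "\<lambda>i l. G l (M i)"]) blast
  qed
qed

lemma PPol_eq_Bij: "PPol {0, 1} k R = Bij (pol k R)"
proof (intro set_eqI)
  fix P :: "nat pmap"
  obtain n f where P: "P = (n, f)" by (cases P)
  show "P \<in> PPol {0, 1} k R \<longleftrightarrow> P \<in> Bij (pol k R)"
  proof (cases "P \<in> BA {0, 1}")
    case BA: True
    have col: "column (map (\<lambda>i. enc n (M i)) [0..<k]) j = enc k (\<lambda>i. M i j)" if "j < n" for M j
      using that by (simp add: column_def enc_def[of k] comp_def)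
    have colf: "column (map f (map (\<lambda>i. enc n (M i)) [0..<k])) j = enc k (\<lambda>i. crd P j (M i))"
      if "j < n" for M j
      using that BA_apply_enc[OF BA] by (simp add: P column_def enc_def[of k] comp_def)
    have rows: "map (\<lambda>i. enc n (M i)) [0..<k] \<in> nlists k (nlists n {0, 1})" for M
      by (rule nlistsI) (simp_all add: image_subset_iff)
    have "respects_rel {0, 1} k R P \<longleftrightarrow> (\<forall>j<n. crd P j \<in> pol k R)"
    proof
      assume resp: "respects_rel {0, 1} k R P"
      show "\<forall>j<n. crd P j \<in> pol k R"
      proof (intro allI impI)
        fix j assume j: "j < n"
        show "crd P j \<in> pol k R"
          unfolding pol_def
        proof (intro CollectI allI impI)
          fix M :: "nat \<Rightarrow> nat \<Rightarrow> bool" assume M: "\<forall>j. enc k (\<lambda>i. M i j) \<in> R"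
          have "\<forall>j<n. column (map (\<lambda>i. enc n (M i)) [0..<k]) j \<in> R" using col M by simp
          then have "\<forall>j<n. column (map f (map (\<lambda>i. enc n (M i)) [0..<k])) j \<in> R"
            using resp rows[of M] unfolding respects_rel_def P by fast
          then show "enc k (\<lambda>i. crd P j (M i)) \<in> R" using colf[OF j] j by metis
        qed
      qed
    next
      assume crd: "\<forall>j<n. crd P j \<in> pol k R"
      show "respects_rel {0, 1} k R P"
        unfolding respects_rel_def P prod.case
      proof (intro ballI impI allI)
        fix N j assume N: "N \<in> nlists k (nlists n {0, 1 :: nat})" and c: "\<forall>j<n. column N j \<in> R" and j: "j < n"
        \<comment> \<open>Columns beyond the arity repeat the first column, so that all of them lie in \<open>R\<close>.\<close>
        define M where "M i l = (N ! i ! (if l < n then l else 0) = 1)" for i l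
        have Ni: "N ! i \<in> bits n" if "i < k" for i using nlistsE_nth_in[OF N that] .
        have "enc n (M i) = N ! i" if "i < k" for i
        proof -
          have "enc n (M i) = enc n (\<lambda>l. N ! i ! l = 1)" by (rule enc_cong) (simp add: M_def)
          then show ?thesis using enc_nth[OF Ni[OF that]] by simp
        qed
        then have NM: "map (\<lambda>i. enc n (M i)) [0..<k] = N"
          using N by (intro nth_equalityI) auto
        have in_R: "enc k (\<lambda>i. M i l) \<in> R" if "l < n" for l
          using col[OF that, of M] c that unfolding NM by metis
        have "enc k (\<lambda>i. M i l) \<in> R" for l
        proof (cases "l < n")
          case False
          then have "(\<lambda>i. M i l) = (\<lambda>i. M i 0)" using j by (simp add: M_def)
          moreover have "0 < n" using j by simp
          ultimately show ?thesis using in_R[of 0] by simp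
        qed (rule in_R)
        then have "enc k (\<lambda>i. crd P j (M i)) \<in> R" using crd j by (simp add: pol_def)
        then show "column (map f N) j \<in> R" using colf[OF j, of M] by (simp add: NM)
      qed
    qed
    then show ?thesis using BA by (simp add: PPol_def Bij_def P)
  qed (simp add: PPol_def Bij_def)
qed

lemma Bij_mono: "(\<And>n F. fin n F \<Longrightarrow> F \<in> K \<Longrightarrow> F \<in> K') \<Longrightarrow> Bij K \<subseteq> Bij K'"
  using crd_fin by (fastforce simp: Bij_def)

lemma Bij_cong: "(\<And>n F. fin n F \<Longrightarrow> F \<in> K \<longleftrightarrow> F \<in> K') \<Longrightarrow> Bij K = Bij K'"
  by (intro equalityI Bij_mono) auto

text \<open>\<open>\<sigma>\<close> maps \<open>T\<close> injectively into \<open>S - T\<close>;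
  equal sizes make this map onto, so every point outside \<open>T\<close> is the image of a point of
  \<open>T\<close>.\<close>

lemma involution_swaps_halves:
  assumes "finite S" "T \<subseteq> S" "card T = card (S - T)"
    and inv: "\<And>x. x \<in> S \<Longrightarrow> \<sigma> x \<in> S" "\<And>x. x \<in> S \<Longrightarrow> \<sigma> (\<sigma> x) = x"
    and T: "\<And>x. x \<in> T \<Longrightarrow> \<sigma> x \<notin> T" and x: "x \<in> S" "x \<notin> T"
  shows "\<sigma> x \<in> T"
proof -
  have inj: "inj_on \<sigma> T" using inv(2) assms(2) by (metis inj_onI subset_iff)
  have "\<sigma> ` T \<subseteq> S - T" using inv(1) T assms(2) by auto
  moreover have "card (\<sigma> ` T) = card (S - T)" using card_image[OF inj] assms(3) by simp
  ultimately have "\<sigma> ` T = S - T" using card_subset_eq[of "S - T"] assms(1) by auto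
  then obtain y where "y \<in> T" "x = \<sigma> y" using x by auto
  then show ?thesis using inv(2) assms(2) by auto
qed

text \<open>If no antipodal pair had both values 1, complementation would map the ones of the
  coordinate into its zeros, and by balance onto them. Antipodal values would then always differ,
  making the coordinate self-dual. The second claim exchanges the roles of 0 and 1.\<close>

lemma not_self_dual_crd:
  assumes P: "P \<in> BA {0, 1}" and j: "j < fst P" and h: "crd P j \<notin> SD"
  shows "\<exists>a. crd P j a \<and> crd P j (\<lambda>i. \<not> a i)"
    and "\<exists>b. \<not> crd P j b \<and> \<not> crd P j (\<lambda>i. \<not> b i)"
proof -
  define n where "n = fst P"
  define f where "f = snd P"
  have f: "f permutes bits n" using P by (simp add: mem_BA f_def n_def)
  define cpl :: "nat list \<Rightarrow> nat list" where "cpl = map (\<lambda>b. 1 - b)"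
  have cpl_in: "cpl xs \<in> bits n" if "xs \<in> bits n" for xs
  proof (rule nlistsI)
    show "set (cpl xs) \<subseteq> {0, 1}" unfolding cpl_def set_map image_subset_iff by (intro ballI) auto
  qed (simp add: cpl_def nlistsE_length[OF that])
  have cpl_cpl: "cpl (cpl xs) = xs" if "xs \<in> bits n" for xs
  proof -
    have "1 - (1 - b) = b" if "b \<in> set xs" for b
      using subsetD[OF nlistsE_set[OF \<open>xs \<in> bits n\<close>] that] by auto
    then show ?thesis by (simp add: cpl_def comp_def map_idI)
  qed
  have cpl_nth: "cpl xs ! j = 1 \<longleftrightarrow> xs ! j \<noteq> 1" if "xs \<in> bits n" for xs
    using j nlistsE_nth_in[OF that, of j] nlistsE_length[OF that] by (auto simp: cpl_def n_def[symmetric])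
  have cpl_enc: "cpl (enc n x) = enc n (\<lambda>i. \<not> x i)" for x
    by (simp add: cpl_def enc_def)
  have crd: "crd P j x \<longleftrightarrow> f (enc n x) ! j = 1" for x by (simp add: crd_def f_def n_def)
  define One where "One = {xs \<in> bits n. f xs ! j = 1}"
  define Zero where "Zero = bits n - One"
  \<comment> \<open>Complementing the output and pulling it back flips coordinate \<open>j\<close>
    of the output, so \<open>?g\<close> exchanges its ones and zeros. This is the balance.\<close>
  let ?g = "\<lambda>xs. inv f (cpl (f xs))"
  have f_in: "f xs \<in> bits n \<longleftrightarrow> xs \<in> bits n" for xs by (rule permutes_in_image[OF f])
  have fg: "f (?g xs) = cpl (f xs)" for xs using permutes_inverses(1)[OF f] by simp
  have g_in: "?g xs \<in> bits n" if "xs \<in> bits n" for xs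
    using that cpl_in f_in fg by metis
  have "bij_betw ?g One Zero"
    by (rule bij_betw_byWitness[where f' = ?g])
      (auto simp: One_def Zero_def g_in fg cpl_nth f_in cpl_cpl permutes_inverses(2)[OF f])
  then have card: "card One = card Zero" by (rule bij_betw_same_card)
  have sub: "One \<subseteq> bits n" "Zero \<subseteq> bits n" "bits n - Zero = One"
    by (auto simp: One_def Zero_def)
  have sd: False if "\<And>x. crd P j (\<lambda>i. \<not> x i) = (\<not> crd P j x)"
    using h that by (simp add: SD_def)
  have mem: "enc n x \<in> One \<longleftrightarrow> crd P j x" "enc n x \<in> Zero \<longleftrightarrow> \<not> crd P j x" for x
    by (simp_all add: One_def Zero_def crd)
  show "\<exists>a. crd P j a \<and> crd P j (\<lambda>i. \<not> a i)"
  proof (rule ccontr)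
    assume none: "\<not> ?thesis"
    have "cpl xs \<notin> One" if "xs \<in> One" for xs
      using none that mem(1) cpl_enc enc_nth[of xs n] sub(1) by (metis subset_iff)
    note sw = involution_swaps_halves[OF finite_bits sub(1) card[unfolded Zero_def] cpl_in cpl_cpl this]
    have "crd P j (\<lambda>i. \<not> x i)" if "\<not> crd P j x" for x
      using sw[of "enc n x"] that by (simp add: mem cpl_enc)
    then show False using sd none by blast
  qed
  show "\<exists>b. \<not> crd P j b \<and> \<not> crd P j (\<lambda>i. \<not> b i)"
  proof (rule ccontr)
    assume none: "\<not> ?thesis"
    have card': "card Zero = card (bits n - Zero)" using card sub(3) by simp
    have "cpl xs \<notin> Zero" if "xs \<in> Zero" for xs
      using none that mem(2) cpl_enc enc_nth[of xs n] sub(2) by (metis subset_iff)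
    note sw = involution_swaps_halves[OF finite_bits sub(2) card' cpl_in cpl_cpl this]
    have "\<not> crd P j (\<lambda>i. \<not> x i)" if "crd P j x" for x
      using sw[of "enc n x"] that by (simp add: mem cpl_enc)
    then show False using sd none by blast
  qed
qed

lemma monotone_crd_Proj:
  assumes P: "P \<in> BA {0, 1}" and mono: "\<And>j. j < fst P \<Longrightarrow> crd P j \<in> Mono" and j: "j < fst P"
  shows "crd P j \<in> Proj"
proof -
  define n where "n = fst P"
  define f where "f = snd P"
  have f: "f permutes bits n" using P by (simp add: mem_BA f_def n_def)
  have f_in: "f xs \<in> bits n \<longleftrightarrow> xs \<in> bits n" for xs by (rule permutes_in_image[OF f])
  have f_enc: "f (enc n x) = enc n (\<lambda>j. crd P j x)" for x
    using BA_apply_enc[OF P] by (simp add: f_def n_def)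
  define le where "le xs ys \<longleftrightarrow> (\<forall>i<n. xs ! i \<le> ys ! i)" for xs ys :: "nat list"
  have le_enc: "le (enc n x) (enc n y) \<longleftrightarrow> (\<forall>i<n. x i \<longrightarrow> y i)" for x y
    by (auto simp: le_def)
  have monoD: "crd P j x \<longrightarrow> crd P j y" if "j < n" "\<And>i. i < n \<Longrightarrow> x i \<longrightarrow> y i" for x y j
  proof -
    \<comment> \<open>\<open>Mono\<close> compares whole assignments, so both are first cleared
      beyond the arity.\<close>
    let ?x = "\<lambda>i. i < n \<and> x i" and ?y = "\<lambda>i. i < n \<and> y i"
    have e: "crd P j x = crd P j ?x" "crd P j y = crd P j ?y"
      by (rule finD[OF crd_fin[of P]], simp add: n_def)+
    have "crd P j \<in> Mono" using mono that(1) by (simp add: n_def)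
    then have "crd P j ?x \<Longrightarrow> crd P j ?y" by (rule MonoD) (use that(2) in auto)
    then show ?thesis unfolding e by blast
  qed
  have f_mono: "le (f xs) (f ys)" if "xs \<in> bits n" "ys \<in> bits n" "le xs ys" for xs ys
  proof -
    from that(1) obtain x where x: "xs = enc n x" by (rule bits_encE)
    from that(2) obtain y where y: "ys = enc n y" by (rule bits_encE)
    show ?thesis using that(3) monoD unfolding x y f_enc le_enc by auto
  qed
  \<comment> \<open>The order relation as a finite set of pairs. A monotone permutation maps it
    injectively into itself, hence onto itself, so the inverse is monotone too.\<close>
  define L where "L = {(xs, ys). xs \<in> bits n \<and> ys \<in> bits n \<and> le xs ys}"
  have "L \<subseteq> bits n \<times> bits n" by (auto simp: L_def)
  then have "finite L" using finite_bits finite_subset by blast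
  moreover have "map_prod f f ` L \<subseteq> L" using f_mono f_in by (auto simp: L_def)
  moreover have "inj_on (map_prod f f) L"
    using permutes_inj[OF f] by (auto simp: inj_on_def inj_def)
  ultimately have surj: "map_prod f f ` L = L" by (rule endo_inj_surj)
  have f_refl: "le xs ys" if "xs \<in> bits n" "ys \<in> bits n" "le (f xs) (f ys)" for xs ys
  proof -
    have "(f xs, f ys) \<in> map_prod f f ` L" unfolding surj using that f_in by (simp add: L_def)
    then show ?thesis using permutes_inj[OF f] by (auto simp: L_def inj_def)
  qed
  have conj: "crd P j (\<lambda>i. x i \<and> y i) = (crd P j x \<and> crd P j y)" for x y
  proof
    assume "crd P j (\<lambda>i. x i \<and> y i)"
    then show "crd P j x \<and> crd P j y"
      using monoD[of j "\<lambda>i. x i \<and> y i"] j by (simp add: n_def)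
  next
    \<comment> \<open>\<open>w\<close> is the meet of the two images. Its preimage lies below both
      arguments, hence below their meet, and applying \<open>f\<close> again gives the missing
      inequality.\<close>
    define w where "w = enc n (\<lambda>j. crd P j x \<and> crd P j y)"
    define z where "z = inv f w"
    have fz: "f z = w" using permutes_inverses(1)[OF f] by (simp add: z_def)
    have z_in: "z \<in> bits n" using f_in[of z] by (simp add: fz w_def)
    have "le z (enc n x)" "le z (enc n y)"
      by (rule f_refl[OF z_in enc_bits], simp add: fz f_enc w_def le_enc)+
    then have "le z (enc n (\<lambda>i. x i \<and> y i))" by (auto simp: le_def)
    then have "le w (f (enc n (\<lambda>i. x i \<and> y i)))" using f_mono[OF z_in enc_bits] fz by simp
    moreover assume "crd P j x \<and> crd P j y"
    ultimately show "crd P j (\<lambda>i. x i \<and> y i)"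
      using j unfolding f_enc w_def le_enc by (auto simp: n_def)
  qed
  \<comment> \<open>Otherwise some \<open>a\<close> and its complement both have value 1. So does
    their meet, the bottom, and by monotonicity every point, against the existence of
    \<open>b\<close>.\<close>
  have "crd P j \<in> SD"
  proof (rule ccontr)
    assume "crd P j \<notin> SD"
    then obtain a b where a: "crd P j a" "crd P j (\<lambda>i. \<not> a i)" and b: "\<not> crd P j b"
      using not_self_dual_crd[OF P j] by blast
    have "crd P j (\<lambda>i. a i \<and> \<not> a i)" using conj[of a "\<lambda>i. \<not> a i"] a by simp
    then show False using monoD[of j "\<lambda>_. False" b] b j by (simp add: n_def)
  qed
  then show ?thesis by (rule lattice_hom_Proj[OF crd_fin[of P] conj])
qed

section \<open>Classification\<close>

lemma fst_parallel: "fst (parallel A P Q) = fst P + fst Q"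
  by (simp add: parallel_def split: prod.split)

lemma snd_parallel: "xs \<in> nlists (fst P + fst Q) A \<Longrightarrow>
    snd (parallel A P Q) xs = snd P (take (fst P) xs) @ snd Q (drop (fst P) xs)"
  by (cases P; cases Q) (simp add: parallel_def)

lemma snd_parallel_outside: "xs \<notin> nlists (fst P + fst Q) A \<Longrightarrow> snd (parallel A P Q) xs = xs"
  by (cases P; cases Q) (simp add: parallel_def)

lemma take_nlists: "xs \<in> nlists (n + m) A \<Longrightarrow> take n xs \<in> nlists n A"
  by (rule nlistsI) (use set_take_subset[of n xs] nlistsE_set in \<open>fastforce+\<close>)

lemma drop_nlists: "xs \<in> nlists (n + m) A \<Longrightarrow> drop n xs \<in> nlists m A"
  by (rule nlistsI) (use set_drop_subset[of n xs] nlistsE_set in \<open>fastforce+\<close>)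

lemma parallel_BA:
  assumes "finite A" and P: "P \<in> BA A" and Q: "Q \<in> BA A"
  shows "parallel A P Q \<in> BA A"
  unfolding mem_BA fst_parallel
proof (rule inj_imp_permutes)
  let ?n = "fst P" and ?m = "fst Q"
  have f: "snd P permutes nlists ?n A" and g: "snd Q permutes nlists ?m A"
    using P Q by (simp_all add: mem_BA)
  have in1: "snd P (take ?n xs) \<in> nlists ?n A" and in2: "snd Q (drop ?n xs) \<in> nlists ?m A"
    if "xs \<in> nlists (?n + ?m) A" for xs
    using permutes_in_image[OF f] permutes_in_image[OF g] take_nlists[OF that] drop_nlists[OF that] by simp_all
  show "inj_on (snd (parallel A P Q)) (nlists (?n + ?m) A)"
  proof (rule inj_onI)
    fix xs ys assume x: "xs \<in> nlists (?n + ?m) A" and y: "ys \<in> nlists (?n + ?m) A"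
      and "snd (parallel A P Q) xs = snd (parallel A P Q) ys"
    then have "snd P (take ?n xs) @ snd Q (drop ?n xs) = snd P (take ?n ys) @ snd Q (drop ?n ys)"
      by (simp add: snd_parallel)
    moreover have "length (snd P (take ?n xs)) = length (snd P (take ?n ys))"
      using nlistsE_length[OF in1[OF x]] nlistsE_length[OF in1[OF y]] by simp
    ultimately have "snd P (take ?n xs) = snd P (take ?n ys)" "snd Q (drop ?n xs) = snd Q (drop ?n ys)"
      by simp_all
    then have "take ?n xs = take ?n ys" "drop ?n xs = drop ?n ys"
      using permutes_inj[OF f] permutes_inj[OF g] by (simp_all add: inj_eq)
    then show "xs = ys" by (metis append_take_drop_id)
  qed
  show "snd (parallel A P Q) xs \<in> nlists (?n + ?m) A" if "xs \<in> nlists (?n + ?m) A" for xs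
    using nlists_appendI[OF in1[OF that] in2[OF that]] by (simp add: snd_parallel[OF that])
qed (simp_all add: assms(1) finite_nlists snd_parallel_outside)

lemma parallel_Bij:
  assumes C: "clone C" and P: "P \<in> Bij C" and Q: "Q \<in> Bij C"
  shows "parallel {0, 1} P Q \<in> Bij C"
proof -
  let ?n = "fst P" and ?m = "fst Q" and ?PQ = "parallel {0, 1} P Q"
  have BA: "P \<in> BA {0, 1}" "Q \<in> BA {0, 1}" using P Q by (simp_all add: Bij_def)
  have take: "take ?n (enc (?n + ?m) x) = enc ?n x" for x
    by (simp add: enc_def take_map)
  have drop: "drop ?n (enc (?n + ?m) x) = enc ?m (\<lambda>i. x (?n + i))" for x
    by (rule nth_equalityI) simp_all
  have len: "length (snd P (enc ?n x)) = ?n" for x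
    using nlistsE_length[OF BA_enc[OF BA(1)]] .
  have crd: "crd ?PQ j x = (if j < ?n then crd P j x else crd Q (j - ?n) (\<lambda>i. x (?n + i)))" for j x
    unfolding crd_def fst_parallel snd_parallel[OF enc_bits] take drop
    by (simp add: nth_append len)
  have "crd ?PQ j \<in> C" if "j < ?n + ?m" for j
  proof (cases "j < ?n")
    case True
    then have "crd P j \<in> C" using P by (simp add: Bij_def)
    then show ?thesis by (rule mem_ext) (simp add: crd True)
  next
    case False
    then have "crd Q (j - ?n) \<in> C" using Q that by (simp add: Bij_def)
    then have "(\<lambda>x. crd Q (j - ?n) (\<lambda>i. x (?n + i))) \<in> C"
      by (rule acts_comp[OF C]) (rule acts_proj[OF C])
    then show ?thesis by (rule mem_ext) (simp add: crd False)
  qed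
  then show ?thesis
    using parallel_BA[OF _ BA] by (simp add: Bij_def fst_parallel)
qed

lemma ident_Bij:
  assumes "clone C"
  shows "ident n \<in> Bij C"
proof -
  have "crd (ident n) j \<in> C" if "j < n" for j
    by (rule mem_ext[OF acts_proj[OF assms, of j]]) (use that in \<open>simp add: crd_def ident_def\<close>)
  then show ?thesis by (simp add: Bij_def mem_BA) (simp add: ident_def permutes_id)
qed

lemma pad_Bij: "clone C \<Longrightarrow> P \<in> Bij C \<Longrightarrow> pad {0, 1} s P \<in> Bij C"
  by (simp add: pad_def parallel_Bij ident_Bij)

lemma fst_pad: "fst P \<le> s \<Longrightarrow> fst (pad A s P) = s"
  by (simp add: pad_def fst_parallel ident_def)

lemma comp_Bij:
  assumes C: "clone C" and P: "P \<in> Bij C" "fst P = s" and Q: "Q \<in> Bij C" "fst Q = s"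
  shows "(s, snd P \<circ> snd Q) \<in> Bij C"
proof -
  have BA: "P \<in> BA {0, 1}" "Q \<in> BA {0, 1}" using P Q by (simp_all add: Bij_def)
  have "(s, snd P \<circ> snd Q) \<in> BA {0, 1}"
    using BA P(2) Q(2) by (simp add: mem_BA permutes_compose)
  moreover have "crd (s, snd P \<circ> snd Q) j \<in> C" if j: "j < s" for j
  proof -
    have PC: "crd P j \<in> C" using P j by (simp add: Bij_def)
    \<comment> \<open>\<open>crd Q i\<close> need not lie in \<open>C\<close> for
      \<open>i \<ge> s\<close>. A projection takes its place, which \<open>crd P j\<close> does not
      notice because it reads only the first \<open>s\<close> variables.\<close>
    have G: "(if i < s then crd Q i else (\<lambda>x. x 0)) \<in> C" for i
      using Q acts_proj[OF C] by (simp add: Bij_def)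
    show ?thesis
    proof (rule mem_ext[OF acts_comp[OF C PC G]])
      fix x
      have "crd (s, snd P \<circ> snd Q) j x = crd P j (\<lambda>i. crd Q i x)"
        using BA_apply_enc[OF BA(2), of x] P(2) Q(2) by (simp add: crd_def)
      also have "\<dots> = crd P j (\<lambda>i. (if i < s then crd Q i else (\<lambda>x. x 0)) x)"
        by (rule finD[OF crd_fin[of P]]) (simp add: P(2))
      finally show "crd (s, snd P \<circ> snd Q) j x = crd P j (\<lambda>i. (if i < s then crd Q i else (\<lambda>x. x 0)) x)" .
    qed
  qed
  ultimately show ?thesis by (simp add: Bij_def)
qed

lemma serial_Bij:
  assumes "clone C" "P \<in> Bij C" "Q \<in> Bij C"
  shows "serial {0, 1} P Q \<in> Bij C"
  unfolding serial_def Let_def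
  by (intro comp_Bij pad_Bij fst_pad assms) simp_all

lemma wire_perm_Bij:
  assumes C: "clone C" and \<alpha>: "\<alpha> permutes {..<n}"
  shows "wire_perm {0, 1} n \<alpha> \<in> Bij C"
proof -
  let ?P = "wire_perm {0, 1 :: nat} n \<alpha>"
  have fst: "fst ?P = n" by (simp add: wire_perm_def)
  have inv_lt: "inv \<alpha> i < n" if "i < n" for i
    using permutes_in_image[OF permutes_inv[OF \<alpha>], of i] that by simp
  have al_lt: "\<alpha> i < n" if "i < n" for i
    using permutes_in_image[OF \<alpha>, of i] that by simp
  have snd: "snd ?P xs = map (\<lambda>i. xs ! inv \<alpha> i) [0..<n]" if "xs \<in> bits n" for xs
    using that by (simp add: wire_perm_def)
  have "snd ?P permutes bits n"
  proof (rule inj_imp_permutes)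
    show "inj_on (snd ?P) (bits n)"
    proof (rule inj_onI)
      fix xs ys assume x: "xs \<in> bits n" and y: "ys \<in> bits n" and eq: "snd ?P xs = snd ?P ys"
      show "xs = ys"
      proof (rule nth_equalityI)
        show "length xs = length ys" using nlistsE_length[OF x] nlistsE_length[OF y] by simp
        fix l assume "l < length xs"
        then have l: "l < n" using nlistsE_length[OF x] by simp
        have "snd ?P xs ! \<alpha> l = snd ?P ys ! \<alpha> l" by (simp only: eq)
        then show "xs ! l = ys ! l"
          using al_lt[OF l] by (simp add: snd x y permutes_inverses(2)[OF \<alpha>])
      qed
    qed
    show "snd ?P xs \<in> bits n" if "xs \<in> bits n" for xs
      unfolding snd[OF that]
      by (rule nlistsI) (use inv_lt nlistsE_nth_in[OF that] in \<open>auto simp: image_subset_iff\<close>)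
    show "snd ?P xs = xs" if "xs \<notin> bits n" for xs using that by (simp add: wire_perm_def)
  qed (rule finite_bits)
  moreover have "crd ?P j \<in> C" if "j < n" for j
    by (rule mem_ext[OF acts_proj[OF C, of "inv \<alpha> j"]])
      (use that inv_lt[OF that] in \<open>simp add: crd_def fst snd\<close>)
  ultimately show ?thesis by (simp add: Bij_def mem_BA fst)
qed

lemma permutation_clone_Bij: "clone C \<Longrightarrow> permutation_clone {0, 1} (Bij C)"
  unfolding permutation_clone_def
  by (simp add: wire_perm_Bij parallel_Bij serial_Bij) (simp add: Bij_def)

text \<open>Only eleven of the sixteen intersections differ: within \<open>SD\<close>, fixing 0 and
  fixing 1 are equivalent, and an affine function fixing both is self-dual. \<open>Lit\<close> and
  \<open>Proj\<close> are the cases in which every coordinate depends on a single variable.\<close>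

definition classes :: "bfun set list" where
  "classes = [UNIV, T0, T1, T0 \<inter> T1, SD, T0 \<inter> SD, Aff, T0 \<inter> Aff, T1 \<inter> Aff, SD \<inter> Aff,
     T0 \<inter> SD \<inter> Aff, Lit, Proj]"

text \<open>Affinity gives F(complement of x) = F(x) + F(1) + F(0), so distinct values at the two
  constants amount to self-duality.\<close>

lemma Aff_not_SD_ends: "F \<in> Aff \<Longrightarrow> F \<notin> SD \<Longrightarrow> F (\<lambda>_. False) = F (\<lambda>_. True)"
proof (rule ccontr)
  assume F: "F \<in> Aff" "F \<notin> SD" and ne: "F (\<lambda>_. False) \<noteq> F (\<lambda>_. True)"
  have "F (\<lambda>i. \<not> x i) = (\<not> F x)" for x
    using AffD[OF F(1), of x "\<lambda>_. True" "\<lambda>_. False"] ne by auto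
  then show False using F(2) by (simp add: SD_def)
qed

lemma Proj_subset: "Proj \<subseteq> Aff" "Lit \<subseteq> SD" "Lit \<subseteq> Aff" "Proj \<subseteq> T0" "Proj \<subseteq> T1" "Proj \<subseteq> Lit"
  by (auto simp: Proj_def Lit_def SD_def Aff_def T0_def T1_def)

text \<open>The case distinction runs over which of \<open>Aff\<close>, \<open>SD\<close>,
  \<open>T0\<close>, \<open>T1\<close> contain all coordinates in \<open>D\<close>. Each failed
  inclusion supplies a witness in \<open>D\<close>, and these witnesses are the hypotheses of the
  generation lemmas.\<close>

lemma Bij_classification:
  assumes C: "clone C"
  shows "Bij C \<in> Bij ` set classes"
proof -
  define D where "D = {crd P j | P j. P \<in> Bij C \<and> j < fst P}"
  have DC: "D \<subseteq> C" by (auto simp: D_def Bij_def)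
  have Dfin: "\<exists>n. fin n F" if "F \<in> D" for F using that crd_fin by (auto simp: D_def)
  have bal: "(\<exists>a. F a \<and> F (\<lambda>i. \<not> a i)) \<and> (\<exists>b. \<not> F b \<and> \<not> F (\<lambda>i. \<not> b i))"
    if F: "F \<in> D" "F \<notin> SD" for F
  proof -
    obtain P j where "F = crd P j" "P \<in> BA {0, 1}" "j < fst P" using F(1) by (auto simp: D_def Bij_def)
    then show ?thesis using not_self_dual_crd[of P j] F(2) by simp
  qed
  have mono: "D \<subseteq> Proj" if "D \<subseteq> Mono"
  proof
    fix F assume "F \<in> D"
    then obtain P j where F: "F = crd P j" and P: "P \<in> Bij C" and j: "j < fst P" by (auto simp: D_def)
    show "F \<in> Proj"
      unfolding F
    proof (rule monotone_crd_Proj[OF _ _ j])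
      show "P \<in> BA {0, 1}" using P by (simp add: Bij_def)
      show "crd P i \<in> Mono" if "i < fst P" for i
        using that P \<open>D \<subseteq> Mono\<close> unfolding D_def by blast
    qed
  qed
  \<comment> \<open>\<open>Bij C\<close> is squeezed: \<open>D\<close> inside \<open>K\<close>
    bounds it above, generation of the finitary part of \<open>K\<close> bounds it below.
    \<open>K\<close> itself need not contain \<open>C\<close>.\<close>
  have eqI: "Bij C \<in> Bij ` set classes"
    if "K \<in> set classes" "D \<subseteq> K" and gen: "\<And>n F. fin n F \<Longrightarrow> F \<in> K \<Longrightarrow> F \<in> C" for K
  proof -
    have "Bij C \<subseteq> Bij K"
    proof
      fix P assume P: "P \<in> Bij C"
      then have "crd P j \<in> K" if "j < fst P" for j
        using that \<open>D \<subseteq> K\<close> unfolding D_def by blast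
      then show "P \<in> Bij K" using P by (simp add: Bij_def)
    qed
    moreover have "Bij K \<subseteq> Bij C" by (rule Bij_mono) (rule gen)
    ultimately show ?thesis using that(1) by auto
  qed
  note CI = clone_Int[OF C]
  show ?thesis
  proof (cases "D \<subseteq> Aff")
    case aff: True
    show ?thesis
    proof (cases "D \<subseteq> SD")
      case sd: True
      show ?thesis
      proof (cases "D \<subseteq> T0")
        case t0: True
        show ?thesis
        proof (cases "D \<subseteq> Proj")
          case True
          show ?thesis
            by (rule eqI[of Proj]) (use True acts_proj[OF C] in \<open>auto simp: classes_def Proj_def\<close>)
        next
          case False
          then obtain g k where g: "g \<in> D" "g \<notin> Proj" "fin k g" using Dfin by blast
          \<comment> \<open>The generation lemma wants a clone inside the class, but
            \<open>C\<close> may be larger and \<open>D\<close> need not be a clone. The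
            intersection is a clone and still contains \<open>D\<close>; the later cases proceed
            alike.\<close>
          have cl: "clone (C \<inter> (T0 \<inter> SD \<inter> Aff))"
            by (intro CI clone_Int clone_T0 clone_SD clone_Aff)
          show ?thesis
          proof (rule eqI[of "T0 \<inter> SD \<inter> Aff"])
            fix n F assume "fin n F" "F \<in> T0 \<inter> SD \<inter> Aff"
            then have "F \<in> C \<inter> (T0 \<inter> SD \<inter> Aff)"
              using odd_sum_gen[OF cl, of g k n F] g DC aff sd t0 by blast
            then show "F \<in> C" by blast
          qed (use aff sd t0 in \<open>auto simp: classes_def\<close>)
        qed
      next
        case False
        then obtain f where f: "f \<in> D" "f \<notin> T0" by blast
        show ?thesis
        proof (cases "D \<subseteq> Lit")
          case True
          then have "f \<in> Lit" using f by blast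
          then obtain i where i: "f = (\<lambda>x. \<not> x i)"
            using f(2) Proj_subset(4) by (auto simp: Lit_def)
          have fC: "f \<in> C" using f DC by blast
          have "(\<lambda>x. \<not> x k) \<in> C" for k
            using acts_comp[OF C fC acts_proj[OF C, of k]] by (simp add: i)
          then have "F \<in> C" if "F \<in> Lit" for F
            using that acts_proj[OF C] by (auto simp: Lit_def Proj_def)
          then show ?thesis by (intro eqI[of Lit]) (use True in \<open>auto simp: classes_def\<close>)
        next
          case False
          then obtain g k where g: "g \<in> D" "g \<notin> Lit" "fin k g" using Dfin by blast
          have cl: "clone (C \<inter> (SD \<inter> Aff))"
            by (intro CI clone_Int clone_SD clone_Aff)
          show ?thesis
          proof (rule eqI[of "SD \<inter> Aff"])
            fix n F assume "fin n F" "F \<in> SD \<inter> Aff"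
            then have "F \<in> C \<inter> (SD \<inter> Aff)"
              using SD_Aff_gen[OF cl, of f g k n F] f g DC aff sd by blast
            then show "F \<in> C" by blast
          qed (use aff sd in \<open>auto simp: classes_def\<close>)
        qed
      qed
    next
      case False
      then obtain h where h: "h \<in> D" "h \<notin> SD" by blast
      then obtain a b where a: "h a" "h (\<lambda>i. \<not> a i)" and b: "\<not> h b" "\<not> h (\<lambda>i. \<not> b i)"
        using bal by blast
      have h01: "h (\<lambda>_. False) = h (\<lambda>_. True)" using Aff_not_SD_ends h aff by blast
      have hC: "h \<in> C" using h DC by blast
      show ?thesis
      proof (cases "D \<subseteq> T0")
        case t0: True
        then have "\<not> h (\<lambda>_. False)" using h by (auto simp: T0_def)
        then have "F \<in> C" if "fin n F" "F \<in> T0 \<inter> Aff" for n F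
          using Aff_T0_gen[OF C hC _ _ a that(1)] that(2) h01 by blast
        then show ?thesis by (intro eqI[of "T0 \<inter> Aff"]) (use aff t0 in \<open>auto simp: classes_def\<close>)
      next
        case False
        then obtain f where f: "f \<in> D" "f \<notin> T0" by blast
        show ?thesis
        proof (cases "D \<subseteq> T1")
          case t1: True
          then have "h (\<lambda>_. True)" using h by (auto simp: T1_def)
          then have "F \<in> C" if "fin n F" "F \<in> T1 \<inter> Aff" for n F
            using Aff_T1_gen[OF C hC _ _ b that(1)] that(2) h01 by blast
          then show ?thesis by (intro eqI[of "T1 \<inter> Aff"]) (use aff t1 in \<open>auto simp: classes_def\<close>)
        next
          case False
          then obtain g where g: "g \<in> D" "g \<notin> T1" by blast
          show ?thesis
          proof (rule eqI[of Aff])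
            fix n F assume "fin n F" "F \<in> Aff"
            then have "F \<in> C \<inter> Aff"
              using Aff_gen[OF CI[OF clone_Aff] _ _ f(2) _ g(2) _ a b, of n F] f g h DC aff by blast
            then show "F \<in> C" by blast
          qed (use aff in \<open>auto simp: classes_def\<close>)
        qed
      qed
    qed
  next
    case False
    then obtain l where l: "l \<in> D" "l \<notin> Aff" by blast
    \<comment> \<open>Were all coordinates monotone, they would be projections and thus
      affine.\<close>
    have "\<not> D \<subseteq> Mono" using mono l Proj_subset(1) by blast
    then obtain m where m: "m \<in> D" "m \<notin> Mono" by blast
    show ?thesis
    proof (cases "D \<subseteq> SD")
      case sd: True
      show ?thesis
      proof (cases "D \<subseteq> T0")
        case t0: True
        show ?thesis
        proof (rule eqI[of "T0 \<inter> SD"])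
          fix n F assume "fin n F" "F \<in> T0 \<inter> SD"
          then have "F \<in> C \<inter> (T0 \<inter> SD)"
            using SD_T0_gen[OF CI[OF clone_Int[OF clone_T0 clone_SD]] _ _ m(2) _ l(2), of n F] m l DC sd t0 by blast
          then show "F \<in> C" by blast
        qed (use sd t0 in \<open>auto simp: classes_def\<close>)
      next
        case False
        then obtain f where f: "f \<in> D" "f \<notin> T0" by blast
        show ?thesis
        proof (rule eqI[of SD])
          fix n F assume "fin n F" "F \<in> SD"
          then have "F \<in> C \<inter> SD"
            using SD_gen[OF CI[OF clone_SD] _ _ f(2) _ l(2), of n F] f l DC sd by blast
          then show "F \<in> C" by blast
        qed (use sd in \<open>auto simp: classes_def\<close>)
      qed
    next
      case False
      then obtain h where h: "h \<in> D" "h \<notin> SD" by blast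
      then obtain a b where ab: "h a" "h (\<lambda>i. \<not> a i)" "\<not> h b" "\<not> h (\<lambda>i. \<not> b i)"
        using bal by blast
      show ?thesis
      proof (cases "D \<subseteq> T0")
        case t0: True
        show ?thesis
        proof (cases "D \<subseteq> T1")
          case t1: True
          show ?thesis
          proof (rule eqI[of "T0 \<inter> T1"])
            fix n F assume "fin n F" "F \<in> T0 \<inter> T1"
            then have "F \<in> C \<inter> (T0 \<inter> T1)"
              using T01_gen[OF CI[OF clone_Int[OF clone_T0 clone_T1]] _ _ ab _ m(2), of n F] h m DC t0 t1 by blast
            then show "F \<in> C" by blast
          qed (use t0 t1 in \<open>auto simp: classes_def\<close>)
        next
          case False
          then obtain f where f: "f \<in> D" "f \<notin> T1" by blast
          have f01: "\<not> f (\<lambda>_. False)" "\<not> f (\<lambda>_. True)" using f t0 by (auto simp: T0_def T1_def)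
          \<comment> \<open>\<open>f\<close> takes the same value at the two constant assignments;
            failing self-duality, it has the antipodal pair that produces XOR.\<close>
          have "f \<notin> SD" using SDD[of f "\<lambda>_. False"] f01 by auto
          then obtain c where c: "f c" "f (\<lambda>i. \<not> c i)" using bal[OF f(1)] by blast
          show ?thesis
          proof (rule eqI[of T0])
            fix n F assume "fin n F" "F \<in> T0"
            then have "F \<in> C \<inter> T0"
              using T0_gen[OF CI[OF clone_T0] _ _ f01(2) c _ l(2), of n F] f l DC t0 by blast
            then show "F \<in> C" by blast
          qed (use t0 in \<open>auto simp: classes_def\<close>)
        qed
      next
        case False
        then obtain f where f: "f \<in> D" "f \<notin> T0" by blast
        show ?thesis
        proof (cases "D \<subseteq> T1")
          case t1: True
          have f01: "f (\<lambda>_. False)" "f (\<lambda>_. True)" using f t1 by (auto simp: T0_def T1_def)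
          have "f \<notin> SD" using SDD[of f "\<lambda>_. False"] f01 by auto
          then obtain c where c: "\<not> f c" "\<not> f (\<lambda>i. \<not> c i)" using bal[OF f(1)] by blast
          show ?thesis
          proof (rule eqI[of T1])
            fix n F assume "fin n F" "F \<in> T1"
            then have "F \<in> C \<inter> T1"
              using T1_gen[OF CI[OF clone_T1] _ _ f01(1) c _ l(2), of n F] f l DC t1 by blast
            then show "F \<in> C" by blast
          qed (use t1 in \<open>auto simp: classes_def\<close>)
        next
          case False
          then obtain g where g: "g \<in> D" "g \<notin> T1" by blast
          show ?thesis
          proof (rule eqI[of UNIV])
            fix n F assume "fin n F"
            then show "F \<in> C"
              using UNIV_gen[OF C _ f(2) _ g(2) _ h(2) _ l(2) _ m(2)] f g h l m DC by blast
          qed (auto simp: classes_def)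
        qed
      qed
    qed
  qed
qed

section \<open>Relations and distinctness\<close>

lemma pol_enc_image:
  assumes "fin k Q"
  shows "pol k (enc k ` {x. Q x}) = {F. \<forall>M. (\<forall>j. Q (\<lambda>i. M i j)) \<longrightarrow> Q (\<lambda>i. F (M i))}"
proof -
  have "enc k x \<in> enc k ` {x. Q x} \<longleftrightarrow> Q x" for x
  proof
    assume "enc k x \<in> enc k ` {x. Q x}"
    then obtain y where y: "enc k x = enc k y" "Q y" by auto
    have "x i = y i" if "i < k" for i
      using arg_cong[OF y(1), of "\<lambda>xs. xs ! i"] that by (cases "x i"; cases "y i") simp_all
    then show "Q x" using finD[OF assms, of x y] y(2) by simp
  qed auto
  then show ?thesis by (simp add: pol_def)
qed

text \<open>The product of the relations defining the four maximal classes, each switched on by a flag.\<close>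

definition rel :: "bool \<Rightarrow> bool \<Rightarrow> bool \<Rightarrow> bool \<Rightarrow> bfun" where
  "rel a b c d v \<longleftrightarrow> (a \<longrightarrow> \<not> v 0) \<and> (b \<longrightarrow> v 1) \<and> (c \<longrightarrow> v 3 = (\<not> v 2)) \<and>
     (d \<longrightarrow> v 7 = (v 4 \<noteq> (v 5 \<noteq> v 6)))"

text \<open>Polymorphisms of a product are common polymorphisms of the factors once no factor is
  empty. Concretely, one array \<open>M\<close> tests all four conditions: its columns satisfy every
  factor, whatever the flags.\<close>

lemma pol_rel:
  "pol 8 (enc 8 ` {x. rel a b c d x}) =
     {F. (a \<longrightarrow> F \<in> T0) \<and> (b \<longrightarrow> F \<in> T1) \<and> (c \<longrightarrow> F \<in> SD) \<and> (d \<longrightarrow> F \<in> Aff)}"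
proof -
  have fin: "fin 8 (rel a b c d)" by (rule finI) (simp add: rel_def)
  have "(\<forall>M. (\<forall>j. rel a b c d (\<lambda>i. M i j)) \<longrightarrow> rel a b c d (\<lambda>i. F (M i))) \<longleftrightarrow>
      (a \<longrightarrow> F \<in> T0) \<and> (b \<longrightarrow> F \<in> T1) \<and> (c \<longrightarrow> F \<in> SD) \<and> (d \<longrightarrow> F \<in> Aff)" (is "?L \<longleftrightarrow> ?R") for F
  proof
    assume L: ?L
    have "(a \<longrightarrow> \<not> F (\<lambda>_. False)) \<and> (b \<longrightarrow> F (\<lambda>_. True)) \<and> (c \<longrightarrow> F (\<lambda>i. \<not> u i) = (\<not> F u)) \<and>
        (d \<longrightarrow> F (\<lambda>i. x i \<noteq> (y i \<noteq> z i)) = (F x \<noteq> (F y \<noteq> F z)))" for u x y z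
    proof -
      define M where "M i = (if i = (1 :: nat) then (\<lambda>_. True) else if i = 2 then u
        else if i = 3 then (\<lambda>j. \<not> u j) else if i = 4 then x else if i = 5 then y
        else if i = 6 then z else if i = 7 then (\<lambda>i. x i \<noteq> (y i \<noteq> z i)) else (\<lambda>_. False))" for i
      have M: "M 0 = (\<lambda>_. False)" "M 1 = (\<lambda>_. True)" "M 2 = u" "M 3 = (\<lambda>j. \<not> u j)" "M 4 = x" "M 5 = y"
        "M 6 = z" "M 7 = (\<lambda>i. x i \<noteq> (y i \<noteq> z i))"
        by (simp_all add: M_def)
      have "\<forall>j. rel a b c d (\<lambda>i. M i j)" unfolding rel_def M by simp
      then have "rel a b c d (\<lambda>i. F (M i))" using L by blast
      then show ?thesis unfolding rel_def M .
    qed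
    then show ?R unfolding T0_def T1_def SD_def Aff_def by blast
  next
    assume R: ?R
    show ?L
    proof (intro allI impI)
      fix M :: "nat \<Rightarrow> nat \<Rightarrow> bool" assume M: "\<forall>j. rel a b c d (\<lambda>i. M i j)"
      have "M 0 = (\<lambda>_. False)" if a using M that by (auto simp: rel_def)
      moreover have "M 1 = (\<lambda>_. True)" if b using M that by (auto simp: rel_def)
      moreover have "M 3 = (\<lambda>j. \<not> M 2 j)" if c using M that by (auto simp: rel_def)
      moreover have "M 7 = (\<lambda>j. M 4 j \<noteq> (M 5 j \<noteq> M 6 j))" if d using M that by (auto simp: rel_def)
      ultimately show "rel a b c d (\<lambda>i. F (M i))"
        using R SDD[of F "M 2"] AffD[of F "M 4" "M 5" "M 6"]
        unfolding rel_def T0_def T1_def mem_Collect_eq by metis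
    qed
  qed
  then show ?thesis unfolding pol_enc_image[OF fin] by simp
qed

text \<open>The not-all-equal relation. It is invariant under complement, so negated variables pass
  along with the variables.\<close>

definition nae :: bfun where
  "nae v \<longleftrightarrow> \<not> (v 0 = v 1 \<and> v 1 = v 2)"

lemma pol_nae_triple:
  assumes F: "\<And>M. (\<And>j. nae (\<lambda>i. M i j)) \<Longrightarrow> nae (\<lambda>i. F (M i))"
    and "\<And>j. \<not> (x j = y j \<and> y j = z j)"
  shows "\<not> (F x = F y \<and> F y = F z)"
proof -
  define M where "M i = (if i = (0 :: nat) then x else if i = 1 then y else z)" for i
  have M: "M 0 = x" "M 1 = y" "M 2 = z" by (simp_all add: M_def)
  have "nae (\<lambda>i. F (M i))" by (rule F) (use assms(2) in \<open>simp add: nae_def M\<close>)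
  then show ?thesis by (simp add: nae_def M)
qed

text \<open>Suitable triples do the work. A repeated complement next to \<open>x\<close> gives
  self-duality; \<open>x\<close>, \<open>y\<close> and the complement of their meet show that the
  ultrafilter is closed under meets; the meet, the complement of \<open>x\<close> and the constant
  True show that it is upward closed.\<close>

lemma pol_nae_Proj:
  assumes F: "\<And>M. (\<And>j. nae (\<lambda>i. M i j)) \<Longrightarrow> nae (\<lambda>i. F (M i))"
    and "fin n F" "F (\<lambda>_. True)"
  shows "F \<in> Proj"
proof (rule lattice_hom_Proj[OF assms(2)])
  note triple = pol_nae_triple[of F, OF F]
  have neg: "F (\<lambda>i. \<not> x i) = (\<not> F x)" for x
    using triple[of x "\<lambda>i. \<not> x i" "\<lambda>i. \<not> x i"] by auto
  then show "F \<in> SD" by (simp add: SD_def)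
  fix x y
  have "F (\<lambda>i. x i \<and> y i)" if "F x" "F y"
    using triple[of x y "\<lambda>i. \<not> (x i \<and> y i)"] neg[of "\<lambda>i. x i \<and> y i"] that by auto
  moreover have "F x" if "F (\<lambda>i. x i \<and> y i)" for x y
    using triple[of "\<lambda>i. x i \<and> y i" "\<lambda>i. \<not> x i" "\<lambda>_. True"] neg[of x] that assms(3) by auto
  moreover have "F (\<lambda>i. y i \<and> x i) = F (\<lambda>i. x i \<and> y i)" by (simp add: conj_commute)
  ultimately show "F (\<lambda>i. x i \<and> y i) = (F x \<and> F y)" by metis
qed

lemma nae_neg: "nae (\<lambda>i. \<not> v i) = nae v"
  by (auto simp: nae_def)

lemma pol_nae_iff_Lit:
  assumes "fin n F"
  shows "(\<forall>M. (\<forall>j. nae (\<lambda>i. M i j)) \<longrightarrow> nae (\<lambda>i. F (M i))) \<longleftrightarrow> F \<in> Lit"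
proof
  assume F: "\<forall>M. (\<forall>j. nae (\<lambda>i. M i j)) \<longrightarrow> nae (\<lambda>i. F (M i))"
  show "F \<in> Lit"
  proof (cases "F (\<lambda>_. True)")
    case True
    then have "F \<in> Proj" using pol_nae_Proj[OF _ assms] F by blast
    then show ?thesis by (simp add: Lit_def)
  next
    case False
    have "(\<lambda>x. \<not> F x) \<in> Proj"
      by (rule pol_nae_Proj[OF _ fin_neg[OF assms]]) (use F False nae_neg in auto)
    then obtain i where i: "(\<lambda>x. \<not> F x) = (\<lambda>x. x i)" unfolding Proj_def by (rule rangeE)
    have "F x = (\<not> x i)" for x using fun_cong[OF i, of x] by blast
    then have "F = (\<lambda>x. \<not> x i)" by (rule ext)
    then show ?thesis by (auto simp: Lit_def)
  qed
next
  assume "F \<in> Lit"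
  then show "\<forall>M. (\<forall>j. nae (\<lambda>i. M i j)) \<longrightarrow> nae (\<lambda>i. F (M i))"
    by (auto simp: Lit_def Proj_def nae_neg)
qed

lemma Bij_Lit_PPol: "Bij Lit = PPol {0, 1} 3 (enc 3 ` {x. nae x})"
proof -
  have fin: "fin 3 nae" by (rule finI) (simp add: nae_def)
  show ?thesis
    unfolding PPol_eq_Bij pol_enc_image[OF fin]
    by (rule Bij_cong) (simp only: mem_Collect_eq pol_nae_iff_Lit)
qed

text \<open>The fourth entry forces the value 1 at the all-True assignment, which rules out the
  negated literals.\<close>

lemma Bij_Proj_PPol: "Bij Proj = PPol {0, 1} 4 (enc 4 ` {x. nae x \<and> x 3})"
proof -
  have fin: "fin 4 (\<lambda>x. nae x \<and> x 3)" by (rule finI) (simp add: nae_def)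
  have "F \<in> Proj \<longleftrightarrow> (\<forall>M. (\<forall>j. nae (\<lambda>i. M i j) \<and> M 3 j) \<longrightarrow> nae (\<lambda>i. F (M i)) \<and> F (M 3))"
    if "fin n F" for n F
  proof
    assume "F \<in> Proj"
    then show "\<forall>M. (\<forall>j. nae (\<lambda>i. M i j) \<and> M 3 j) \<longrightarrow> nae (\<lambda>i. F (M i)) \<and> F (M 3)"
      by (auto simp: Proj_def)
  next
    assume F: "\<forall>M. (\<forall>j. nae (\<lambda>i. M i j) \<and> M 3 j) \<longrightarrow> nae (\<lambda>i. F (M i)) \<and> F (M 3)"
    have *: "nae (\<lambda>i. F (M i)) \<and> F (\<lambda>_. True)" if M: "\<And>j. nae (\<lambda>i. M i j)" for M
    proof -
      define N where "N = M(3 := (\<lambda>_. True))"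
      have N: "N 0 = M 0" "N 1 = M 1" "N 2 = M 2" "N 3 = (\<lambda>_. True)" by (simp_all add: N_def)
      have "\<forall>j. nae (\<lambda>i. N i j) \<and> N 3 j" using M by (simp add: nae_def N)
      then have "nae (\<lambda>i. F (N i)) \<and> F (N 3)" using F by blast
      then show ?thesis unfolding nae_def N .
    qed
    \<comment> \<open>The conclusion about the fourth row is available only once some array with
      admissible columns exists; a constant one is enough.\<close>
    have "nae (\<lambda>i. i = 0)" by (simp add: nae_def)
    then have "F (\<lambda>_. True)" using *[of "\<lambda>i _. i = 0"] by blast
    then show "F \<in> Proj" by (intro pol_nae_Proj[OF _ that]) (use * in auto)
  qed
  then show ?thesis
    unfolding PPol_eq_Bij pol_enc_image[OF fin]
    by (intro Bij_cong) (simp only: mem_Collect_eq)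
qed

lemma enc_image_subset: "enc k ` X \<subseteq> nlists k {0, 1}"
  using enc_bits by blast

lemma Bij_classes_PPol:
  assumes "K \<in> set classes"
  shows "\<exists>k\<ge>1. \<exists>R \<subseteq> nlists k {0, 1}. Bij K = PPol {0, 1} k R"
proof -
  have "K = Lit \<or> K = Proj \<or> (\<exists>a b c d. K = pol 8 (enc 8 ` {x. rel a b c d x}))"
  proof -
    define cls where "cls a b c d = {F. (a \<longrightarrow> F \<in> T0) \<and> (b \<longrightarrow> F \<in> T1) \<and> (c \<longrightarrow> F \<in> SD) \<and> (d \<longrightarrow> F \<in> Aff)}"
      for a b c d
    have "UNIV = cls False False False False" "T0 = cls True False False False"
      "T1 = cls False True False False" "T0 \<inter> T1 = cls True True False False"
      "SD = cls False False True False" "T0 \<inter> SD = cls True False True False"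
      "Aff = cls False False False True" "T0 \<inter> Aff = cls True False False True"
      "T1 \<inter> Aff = cls False True False True" "SD \<inter> Aff = cls False False True True"
      "T0 \<inter> SD \<inter> Aff = cls True False True True"
      by (simp_all add: cls_def Int_def conj_assoc)
    then have "K = Lit \<or> K = Proj \<or> (\<exists>a b c d. K = cls a b c d)"
      using assms unfolding classes_def list.set insert_iff empty_iff by (elim disjE) blast+
    then show ?thesis unfolding pol_rel cls_def .
  qed
  then show ?thesis
  proof (elim disjE exE)
    assume "K = Lit"
    then show ?thesis
      by (intro exI[of _ 3] conjI exI[of _ "enc 3 ` {x. nae x}"] enc_image_subset) (simp_all add: Bij_Lit_PPol)
  next
    assume "K = Proj"
    then show ?thesis
      by (intro exI[of _ 4] conjI exI[of _ "enc 4 ` {x. nae x \<and> x 3}"] enc_image_subset) (simp_all add: Bij_Proj_PPol)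
  next
    fix a b c d assume "K = pol 8 (enc 8 ` {x. rel a b c d x})"
    then show ?thesis
      by (intro exI[of _ 8] conjI exI[of _ "enc 8 ` {x. rel a b c d x}"] enc_image_subset) (simp_all add: PPol_eq_Bij)
  qed
qed

lemma relationally_defined_clones: "{C. relationally_defined_clone {0, 1 :: nat} C} = Bij ` set classes"
proof (intro equalityI subsetI)
  fix C assume "C \<in> {C. relationally_defined_clone {0, 1 :: nat} C}"
  then obtain k R where "C = PPol {0, 1} k R" by (auto simp: relationally_defined_clone_def)
  then show "C \<in> Bij ` set classes"
    using Bij_classification[OF clone_pol, of k R] by (simp add: PPol_eq_Bij)
next
  fix C assume "C \<in> Bij ` set classes"
  then obtain K where K: "K \<in> set classes" "C = Bij K" by auto
  obtain k R where kR: "k \<ge> 1" "R \<subseteq> nlists k {0, 1}" "C = PPol {0, 1} k R"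
    using Bij_classes_PPol[OF K(1)] K(2) by auto
  have "permutation_clone {0, 1} C"
    unfolding kR(3) PPol_eq_Bij by (rule permutation_clone_Bij[OF clone_pol])
  then show "C \<in> {C. relationally_defined_clone {0, 1 :: nat} C}"
    using kR by (auto simp: relationally_defined_clone_def)
qed

text \<open>Gates separating the classes. \<open>CNOT\<close> and \<open>CNOT_dual\<close> flip the
  last bit when the first is 1 or 0, respectively, and \<open>Fredkin\<close> exchanges the last two
  bits when the first is 1. \<open>antipodal_swap\<close> exchanges two antipodal points other than
  000 and 111, so it stays in \<open>T0\<close>, \<open>T1\<close> and \<open>SD\<close> but is not
  affine. \<open>parity_gate\<close> puts the sum of all three bits in the first place.\<close>

definition NOT_gate :: "nat pmap" where "NOT_gate = (1, transpose [0] [1])"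
definition CNOT :: "nat pmap" where "CNOT = (2, transpose [1, 0] [1, 1])"
definition CNOT_dual :: "nat pmap" where "CNOT_dual = (2, transpose [0, 0] [0, 1])"
definition Fredkin :: "nat pmap" where "Fredkin = (3, transpose [1, 0, 1] [1, 1, 0])"
definition antipodal_swap :: "nat pmap" where "antipodal_swap = (3, transpose [0, 0, 1] [1, 1, 0])"
definition parity_gate :: "nat pmap" where
  "parity_gate = (3, transpose [0, 0, 1] [1, 0, 1] \<circ> transpose [0, 1, 0] [1, 1, 0])"

lemma mem_Bij_explicit:
  assumes "f permutes bits n" "\<And>x. f (enc n x) = enc n (\<lambda>j. G j x)"
  shows "(n, f) \<in> Bij K \<longleftrightarrow> (\<forall>j<n. G j \<in> K)"
proof -
  have "crd (n, f) j = G j" if "j < n" for j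
  proof
    fix x show "crd (n, f) j x = G j x" using that by (simp add: crd_def assms(2))
  qed
  then show ?thesis using assms(1) by (simp add: Bij_def mem_BA)
qed

lemma enc_numeral:
  "enc 1 x = [of_bool (x 0)]" "enc 2 x = [of_bool (x 0), of_bool (x 1)]"
  "enc 3 x = [of_bool (x 0), of_bool (x 1), of_bool (x 2)]"
  by (simp_all add: enc_def upt_rec numeral_2_eq_2 numeral_3_eq_3 One_nat_def)

lemma all_less_numeral:
  "(\<forall>j<1::nat. P j) \<longleftrightarrow> P 0" "(\<forall>j<2::nat. P j) \<longleftrightarrow> P 0 \<and> P 1" "(\<forall>j<3::nat. P j) \<longleftrightarrow> P 0 \<and> P 1 \<and> P 2"
  by (auto simp: less_Suc_eq numeral_2_eq_2 numeral_3_eq_3 One_nat_def)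

lemma list_in_bits:
  "[a] \<in> bits 1 \<longleftrightarrow> a \<in> {0, 1}" "[a, b] \<in> bits 2 \<longleftrightarrow> a \<in> {0, 1} \<and> b \<in> {0, 1}"
  "[a, b, c] \<in> bits 3 \<longleftrightarrow> a \<in> {0, 1} \<and> b \<in> {0, 1} \<and> c \<in> {0, 1}"
  by (simp_all only: numeral_2_eq_2 numeral_3_eq_3 One_nat_def Cons_in_nlists_Suc nlists_n_0 singleton_iff simp_thms)

lemma NOT_gate_Bij: "NOT_gate \<in> Bij K \<longleftrightarrow> (\<lambda>x. \<not> x 0) \<in> K"
proof -
  have "transpose [0] [1] (enc 1 x) = enc 1 (\<lambda>j. \<not> x 0)" for x
    by (cases "x 0") (simp_all add: enc_numeral transpose_def)
  moreover have "transpose [0] [1] permutes bits 1" by (rule permutes_swap_id) (simp_all add: list_in_bits)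
  ultimately show ?thesis
    unfolding NOT_gate_def by (subst mem_Bij_explicit[of _ _ "\<lambda>j x. \<not> x 0"]) (simp_all add: all_less_numeral)
qed

lemma CNOT_Bij: "CNOT \<in> Bij K \<longleftrightarrow> (\<lambda>x. x 0) \<in> K \<and> (\<lambda>x. x 0 \<noteq> x 1) \<in> K"
proof -
  let ?G = "\<lambda>j x. if j = (0 :: nat) then x 0 else x 0 \<noteq> x (1 :: nat)"
  have "transpose [1, 0] [1, 1] (enc 2 x) = enc 2 (\<lambda>j. ?G j x)" for x
    by (cases "x 0"; cases "x 1") (simp_all add: enc_numeral transpose_def)
  moreover have "transpose [1, 0] [1, 1] permutes bits 2" by (rule permutes_swap_id) (simp_all add: list_in_bits)
  ultimately show ?thesis
    unfolding CNOT_def by (subst mem_Bij_explicit[of _ _ ?G]) (simp_all add: all_less_numeral)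
qed

lemma CNOT_dual_Bij: "CNOT_dual \<in> Bij K \<longleftrightarrow> (\<lambda>x. x 0) \<in> K \<and> (\<lambda>x. x 0 = x 1) \<in> K"
proof -
  let ?G = "\<lambda>j x. if j = (0 :: nat) then x 0 else x 0 = x (1 :: nat)"
  have "transpose [0, 0] [0, 1] (enc 2 x) = enc 2 (\<lambda>j. ?G j x)" for x
    by (cases "x 0"; cases "x 1") (simp_all add: enc_numeral transpose_def)
  moreover have "transpose [0, 0] [0, 1] permutes bits 2" by (rule permutes_swap_id) (simp_all add: list_in_bits)
  ultimately show ?thesis
    unfolding CNOT_dual_def by (subst mem_Bij_explicit[of _ _ ?G]) (simp_all add: all_less_numeral)
qed

lemma Fredkin_Bij:
  "Fredkin \<in> Bij K \<longleftrightarrow> (\<lambda>x. x 0) \<in> K \<and> (\<lambda>x. if x 0 then x 2 else x 1) \<in> K \<and> (\<lambda>x. if x 0 then x 1 else x 2) \<in> K"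
proof -
  let ?G = "\<lambda>j x. if j = (0 :: nat) then x 0 else if j = 1 then (if x 0 then x 2 else x 1)
    else (if x 0 then x (1 :: nat) else x 2)"
  have "transpose [1, 0, 1] [1, 1, 0] (enc 3 x) = enc 3 (\<lambda>j. ?G j x)" for x
    by (cases "x 0"; cases "x 1"; cases "x 2") (simp_all add: enc_numeral transpose_def)
  moreover have "transpose [1, 0, 1] [1, 1, 0] permutes bits 3" by (rule permutes_swap_id) (simp_all add: list_in_bits)
  ultimately show ?thesis
    unfolding Fredkin_def by (subst mem_Bij_explicit[of _ _ ?G]) (simp_all add: all_less_numeral)
qed

text \<open>The bracket is true exactly at 001 and 110, where every bit is flipped.\<close>

lemma antipodal_swap_Bij:
  "antipodal_swap \<in> Bij K \<longleftrightarrow> (\<forall>j<3. (\<lambda>x. x j \<noteq> (x 0 = x 1 \<and> x 2 \<noteq> x 0)) \<in> K)"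
proof -
  let ?G = "\<lambda>j x. x j \<noteq> (x 0 = x 1 \<and> x (2 :: nat) \<noteq> x 0)"
  have "transpose [0, 0, 1] [1, 1, 0] (enc 3 x) = enc 3 (\<lambda>j. ?G j x)" for x
    by (cases "x 0"; cases "x 1"; cases "x 2") (simp_all add: enc_numeral transpose_def)
  moreover have "transpose [0, 0, 1] [1, 1, 0] permutes bits 3" by (rule permutes_swap_id) (simp_all add: list_in_bits)
  ultimately show ?thesis
    unfolding antipodal_swap_def by (subst mem_Bij_explicit[of _ _ ?G]) simp_all
qed

lemma parity_gate_Bij:
  "parity_gate \<in> Bij K \<longleftrightarrow> (\<lambda>x. x 0 \<noteq> (x 1 \<noteq> x 2)) \<in> K \<and> (\<lambda>x. x 1) \<in> K \<and> (\<lambda>x. x 2) \<in> K"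
proof -
  let ?f = "transpose [0, 0, 1] [1, 0, 1] \<circ> transpose [0, 1, 0] [1, 1, 0 :: nat]"
  let ?G = "\<lambda>j x. if j = (0 :: nat) then x 0 \<noteq> (x 1 \<noteq> x 2) else x j"
  have "?f (enc 3 x) = enc 3 (\<lambda>j. ?G j x)" for x
    by (cases "x 0"; cases "x 1"; cases "x 2") (simp_all add: enc_numeral transpose_def)
  moreover have "?f permutes bits 3"
    by (intro permutes_compose permutes_swap_id) (simp_all add: list_in_bits)
  ultimately show ?thesis
    unfolding parity_gate_def by (subst mem_Bij_explicit[of _ _ ?G]) (simp_all add: all_less_numeral)
qed

lemma not_SD_xor: "(\<lambda>x. x 0 \<noteq> x 1) \<notin> SD" "(\<lambda>x. x 0 = x 1) \<notin> SD"
  by (auto simp: SD_def)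

lemma not_SD_mux: "(\<lambda>x. if x 0 then x 2 else x 1) \<notin> SD"
proof
  assume "(\<lambda>x. if x 0 then x 2 else x 1) \<in> SD"
  from SDD[OF this, of "\<lambda>i. i = 1"] show False by simp
qed

lemma not_Aff_mux: "(\<lambda>x. if x 0 then x 2 else x 1) \<notin> Aff"
proof
  assume "(\<lambda>x. if x 0 then x 2 else x 1) \<in> Aff"
  from AffD[OF this, of "\<lambda>i. i = 0" "\<lambda>i. i = 2" "\<lambda>_. False"] show False by simp
qed

lemma not_Aff_antipodal: "(\<lambda>x. x 0 \<noteq> (x 0 = x 1 \<and> x 2 \<noteq> x 0)) \<notin> Aff"
proof
  assume "(\<lambda>x. x 0 \<noteq> (x 0 = x 1 \<and> x 2 \<noteq> x 0)) \<in> Aff"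
  from AffD[OF this, of "\<lambda>i. i = 0" "\<lambda>i. i = 2" "\<lambda>_. False"] show False by simp
qed

lemma not_Lit_parity: "(\<lambda>x. x 0 \<noteq> (x 1 \<noteq> x 2)) \<notin> Lit"
proof
  assume "(\<lambda>x. x 0 \<noteq> (x 1 \<noteq> x 2)) \<in> Lit"
  then show False
    unfolding Lit_def Proj_def
  proof (elim UnE rangeE)
    fix i :: nat assume "(\<lambda>x. x 0 \<noteq> (x 1 \<noteq> x 2)) = (\<lambda>x. x i)"
    note eq = fun_cong[OF this]
    from eq[of "\<lambda>k. k = 0"] eq[of "\<lambda>k. k = 1"] show False by simp
  next
    fix i :: nat assume "(\<lambda>x. x 0 \<noteq> (x 1 \<noteq> x 2)) = (\<lambda>x. \<not> x i)"
    from fun_cong[OF this, of "\<lambda>_. False"] show False by simp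
  qed
qed

section \<open>Membership of the gates in the classes\<close>

lemmas class_defs = T0_def T1_def SD_def Aff_def Lit_def Proj_def

lemma NOT_gate_mem:
  "NOT_gate \<notin> Bij T0" "NOT_gate \<notin> Bij T1" "NOT_gate \<in> Bij SD" "NOT_gate \<in> Bij Aff" "NOT_gate \<in> Bij Lit"
  unfolding NOT_gate_Bij by (auto simp: class_defs)

lemma CNOT_mem: "CNOT \<in> Bij T0" "CNOT \<notin> Bij T1" "CNOT \<notin> Bij SD" "CNOT \<in> Bij Aff"
  unfolding CNOT_Bij using not_SD_xor by (auto simp: T0_def T1_def Aff_def)

lemma CNOT_dual_mem: "CNOT_dual \<notin> Bij T0" "CNOT_dual \<in> Bij T1" "CNOT_dual \<notin> Bij SD" "CNOT_dual \<in> Bij Aff"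
  unfolding CNOT_dual_Bij using not_SD_xor by (auto simp: T0_def T1_def Aff_def)

lemma Fredkin_mem: "Fredkin \<in> Bij T0" "Fredkin \<in> Bij T1" "Fredkin \<notin> Bij SD" "Fredkin \<notin> Bij Aff"
  unfolding Fredkin_Bij using not_SD_mux not_Aff_mux by (auto simp: T0_def T1_def)

lemma antipodal_swap_mem:
  "antipodal_swap \<in> Bij T0" "antipodal_swap \<in> Bij T1" "antipodal_swap \<in> Bij SD" "antipodal_swap \<notin> Bij Aff"
  unfolding antipodal_swap_Bij using not_Aff_antipodal
  by (auto simp: T0_def T1_def SD_def all_less_numeral)

lemma parity_gate_mem:
  "parity_gate \<in> Bij T0" "parity_gate \<in> Bij T1" "parity_gate \<in> Bij SD" "parity_gate \<in> Bij Aff" "parity_gate \<notin> Bij Lit"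
  unfolding parity_gate_Bij using not_Lit_parity by (auto simp: T0_def T1_def SD_def Aff_def)

lemma Bij_Int: "P \<in> Bij (K \<inter> K') \<longleftrightarrow> P \<in> Bij K \<and> P \<in> Bij K'"
  by (auto simp: Bij_def)

lemma Bij_UNIV: "P \<in> Bij K \<Longrightarrow> P \<in> Bij UNIV"
  by (simp add: Bij_def)

lemma not_Bij_Lit: "P \<notin> Bij SD \<Longrightarrow> P \<notin> Bij Lit" "P \<notin> Bij Aff \<Longrightarrow> P \<notin> Bij Lit"
  using Proj_subset by (auto simp: Bij_def)

lemma not_Bij_Proj: "P \<notin> Bij Lit \<Longrightarrow> P \<notin> Bij Proj" "P \<notin> Bij T0 \<Longrightarrow> P \<notin> Bij Proj"
  using Proj_subset by (auto simp: Bij_def)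

text \<open>Each class is recorded by the six truth values telling which gates it contains. The
  thirteen records differ: \<open>UNIV\<close> has all the gates, \<open>Lit\<close> only
  \<open>NOT_gate\<close>, \<open>Proj\<close> none.\<close>

lemma distinct_classes: "distinct (map Bij classes)"
proof -
  let ?test = "\<lambda>X. map (\<lambda>P. P \<in> X) [NOT_gate, CNOT, CNOT_dual, Fredkin, antipodal_swap, parity_gate]"
  note mem = NOT_gate_mem CNOT_mem CNOT_dual_mem Fredkin_mem antipodal_swap_mem parity_gate_mem
  have UNIV: "NOT_gate \<in> Bij UNIV" "CNOT \<in> Bij UNIV" "CNOT_dual \<in> Bij UNIV" "Fredkin \<in> Bij UNIV"
    "antipodal_swap \<in> Bij UNIV" "parity_gate \<in> Bij UNIV"
    using mem Bij_UNIV by blast+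
  have Lit: "CNOT \<notin> Bij Lit" "CNOT_dual \<notin> Bij Lit" "Fredkin \<notin> Bij Lit" "antipodal_swap \<notin> Bij Lit"
    using mem not_Bij_Lit by blast+
  have Proj: "NOT_gate \<notin> Bij Proj" "CNOT \<notin> Bij Proj" "CNOT_dual \<notin> Bij Proj" "Fredkin \<notin> Bij Proj"
    "antipodal_swap \<notin> Bij Proj" "parity_gate \<notin> Bij Proj"
    using mem Lit not_Bij_Proj by blast+
  have "distinct (map ?test (map Bij classes))"
    by (simp add: classes_def Bij_Int mem UNIV Lit Proj)
  then show ?thesis unfolding distinct_map by (rule conjunct1)
qed

theorem theorem10:
  "card {C. relationally_defined_clone {0, 1 :: nat} C} = 13"
proof -
  have "card (Bij ` set classes) = length (map Bij classes)"
    using distinct_card[OF distinct_classes] by simp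
  then show ?thesis by (simp add: relationally_defined_clones classes_def)
qed

end
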